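(* Let $\lambda:\mathbb N\to\mathbb N$ be any function with $\lambda(n)\to\infty$. For every $\gamma>0$ there exists $\rho>0$ such that for every $\lambda$-well-behaved feasible degree sequence $\mathcal D$ of length $n$, the probability that $G(\mathcal D)$ has a component of order at least $\gamma n$ and $H(\mathcal D)$ has no component of size at least $\rho M_{\mathcal D}$ is $o(1)$ (as $n\to\infty$, uniformly in such $\mathcal D$).
   Context: A degree sequence $\mathcal D=(d_1,\dots,d_n)$ consists of positive integers (no zero entries) and is feasible if some simple graph on $\{1,\dots,n\}$ has vertex $i$ of degree $d_i$; $G(\mathcal D)$ is a uniformly random simple graph on $\{1,\dots,n\}$ with vertex $i$ of degree $d_i$. $M_{\mathcal D}=\sum_{i:d_i\ne 2}d_i$, and $\mathcal D$ is $\lambda$-well-behaved if $M_{\mathcal D}\ge\lambda(n)$. A component is cyclic if it is a cycle. $H(\mathcal D)$ is the multigraph obtained from $G(\mathcal D)$ by deleting all cyclic components and then suppressing every vertex of degree 2 (deleting it and joining its two neighbours by an edge, possibly creating loops and multiple edges). The order of a (multi)graph is its number of vertices and its size is its number of edges. *)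

theory Defs
  imports "HOL-Probability.Probability" "HOL-Library.Multiset"
begin

(* An edge is the multiset of its two end vertices; {#u, u#} is a loop at u. *)
record 'a multigraph =
  verts :: "'a set"
  edges :: "'a multiset multiset"

definition multigraph :: "'a multigraph \<Rightarrow> bool" where
  "multigraph G \<longleftrightarrow> finite (verts G) \<and>
     (\<forall>e \<in># edges G. size e = 2 \<and> set_mset e \<subseteq> verts G)"

definition simple :: "'a multigraph \<Rightarrow> bool" where
  "simple G \<longleftrightarrow> multigraph G \<and>
     (\<forall>e \<in># edges G. count (edges G) e = 1 \<and> (\<exists>u v. u \<noteq> v \<and> e = {#u, v#}))"

(* A loop contributes 2 to the degree of its vertex. *)
definition degree :: "'a multigraph \<Rightarrow> 'a \<Rightarrow> nat" where
  "degree G v = (\<Sum>e \<in># edges G. count e v)"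

definition adjacent :: "'a multigraph \<Rightarrow> 'a \<Rightarrow> 'a \<Rightarrow> bool" where
  "adjacent G u v \<longleftrightarrow> {#u, v#} \<in># edges G"

definition induced :: "'a multigraph \<Rightarrow> 'a set \<Rightarrow> 'a multigraph" where
  "induced G S = \<lparr>verts = verts G \<inter> S, edges = {#e \<in># edges G. set_mset e \<subseteq> S#}\<rparr>"

definition components :: "'a multigraph \<Rightarrow> 'a multigraph set" where
  "components G =
     (\<lambda>u. induced G {v \<in> verts G. (adjacent G)\<^sup>*\<^sup>* u v}) ` verts G"

definition is_cycle :: "'a multigraph \<Rightarrow> bool" where
  "is_cycle G \<longleftrightarrow> (\<exists>xs. distinct xs \<and> length xs \<ge> 3 \<and> verts G = set xs \<and>
     edges G = mset (map (\<lambda>i. {#xs ! i, xs ! (Suc i mod length xs)#}) [0..<length xs]))"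

definition delete_cyclic :: "'a multigraph \<Rightarrow> 'a multigraph" where
  "delete_cyclic G =
     induced G (verts G - \<Union> (verts ` {C \<in> components G. is_cycle C}))"

(* The other end vertices of the edges at v, with multiplicity; a loop at v contributes v. *)
definition neighbours :: "'a multigraph \<Rightarrow> 'a \<Rightarrow> 'a multiset" where
  "neighbours G v = (\<Sum>e \<in># filter_mset (\<lambda>e. v \<in># e) (edges G). e - {#v#})"

(* Intended for a vertex v of degree 2 without a loop: then neighbours G v is {#u, w#}, and this
   multiset is itself the new edge joining u and w (a loop if u = w). *)
definition suppress :: "'a \<Rightarrow> 'a multigraph \<Rightarrow> 'a multigraph" where
  "suppress v G =
     \<lparr>verts = verts G - {v},
      edges = add_mset (neighbours G v) {#e \<in># edges G. v \<notin># e#}\<rparr>"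

(* Suppressing a loopless vertex of degree 2 leaves all other degrees unchanged, so the vertices
   to be suppressed can be fixed in advance.  Every component left after deleting the cyclic ones
   has a vertex of degree other than 2, hence no vertex carries a loop when it is suppressed.
   The increasing order serves only to make the definition a function. *)
definition suppressed :: "'a::linorder multigraph \<Rightarrow> 'a multigraph" where
  "suppressed G =
     (let G' = delete_cyclic G
      in fold suppress (sorted_list_of_set {v \<in> verts G'. degree G' v = 2}) G')"

(* A degree sequence (d 1, ..., d n) is given by n and d; values of d outside {1..n} are
   irrelevant. *)
definition graphs_with_degrees :: "nat \<Rightarrow> (nat \<Rightarrow> nat) \<Rightarrow> nat multigraph set" where
  "graphs_with_degrees n d =
     {G. simple G \<and> verts G = {1..n} \<and> (\<forall>i \<in> {1..n}. degree G i = d i)}"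

definition degree_sequence :: "nat \<Rightarrow> (nat \<Rightarrow> nat) \<Rightarrow> bool" where
  "degree_sequence n d \<longleftrightarrow> (\<forall>i \<in> {1..n}. d i > 0)"

definition feasible :: "nat \<Rightarrow> (nat \<Rightarrow> nat) \<Rightarrow> bool" where
  "feasible n d \<longleftrightarrow> graphs_with_degrees n d \<noteq> {}"

definition M_deg :: "nat \<Rightarrow> (nat \<Rightarrow> nat) \<Rightarrow> nat" where
  "M_deg n d = (\<Sum>i \<in> {i \<in> {1..n}. d i \<noteq> 2}. d i)"

definition well_behaved :: "(nat \<Rightarrow> nat) \<Rightarrow> nat \<Rightarrow> (nat \<Rightarrow> nat) \<Rightarrow> bool" where
  "well_behaved lam n d \<longleftrightarrow> M_deg n d \<ge> lam n"

(* pmf_of_set is the uniform distribution only on finite nonempty sets. *)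
lemma finite_graphs_with_degrees: "finite (graphs_with_degrees n d)"
proof -
  let ?P = "(\<lambda>(u, v). {#u, v#}) ` ({1..n} \<times> {1..n})"
  let ?S = "(\<lambda>A. \<lparr>verts = {1..n}, edges = mset_set A\<rparr>) ` Pow ?P"
  have "graphs_with_degrees n d \<subseteq> ?S"
  proof
    fix G assume G: "G \<in> graphs_with_degrees n d"
    then have V: "verts G = {1..n}" and s: "simple G"
      by (auto simp: graphs_with_degrees_def)
    have E: "edges G = mset_set (set_mset (edges G))"
    proof (rule multiset_eqI)
      fix e show "count (edges G) e = count (mset_set (set_mset (edges G))) e"
        using s by (cases "e \<in># edges G") (auto simp: simple_def not_in_iff)
    qed
    have "set_mset (edges G) \<subseteq> ?P"
    proof
      fix e assume e: "e \<in># edges G"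
      then obtain u v where "e = {#u, v#}" using s by (auto simp: simple_def)
      moreover have "set_mset e \<subseteq> {1..n}"
        using e s V by (auto simp: simple_def multigraph_def)
      ultimately show "e \<in> ?P" by auto
    qed
    moreover have "G = \<lparr>verts = {1..n}, edges = mset_set (set_mset (edges G))\<rparr>"
      using V E by (cases G) simp
    ultimately show "G \<in> ?S" by blast
  qed
  then show ?thesis by (rule finite_subset) simp
qed

definition random_graph :: "nat \<Rightarrow> (nat \<Rightarrow> nat) \<Rightarrow> nat multigraph pmf" where
  "random_graph n d = pmf_of_set (graphs_with_degrees n d)"

end

theory Submission
  imports Defs
begin

text \<open>
Write \<open>M\<close> for the sum of the degrees other than 2 and \<open>m(S)\<close> for its restriction to a vertex set
\<open>S\<close>. Suppression turns a component \<open>S\<close> with \<open>m(S) > 0\<close> into a component of size \<open>m(S) / 2\<close>, so in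
the bad event some component has order at least \<open>\<gamma> n\<close> while \<open>m(S) < 2 \<rho> M\<close> for every component \<open>S\<close>.

If \<open>M \<le> 200 n\<close> and \<open>\<rho>\<close> is small, then the large component contains at least \<open>\<gamma> n / 2\<close> vertices of
degree 2. Let \<open>p\<^sub>c\<close> count the pairs of a graph and a component \<open>S\<close> with \<open>m(S) < 2 \<rho> M\<close> and exactly \<open>c\<close>
vertices of degree 2. Taking such a vertex out of \<open>S\<close> and inserting it into an edge outside \<open>S\<close>
injects these moves into the reverse moves, and comparing the numbers of moves gives
\<open>p\<^sub>c (1 + M / (16 n)) \<le> p\<^sub>c\<^sub>-\<^sub>1\<close> for \<open>c \<ge> \<gamma> n / 4\<close>. Iterating this about \<open>\<gamma> n / 4\<close> times bounds the
probability by a constant multiple of \<open>1 / M\<close>.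

If \<open>M > 200 n\<close>, then the components can be split into two parts, each with at least a quarter of the total
degree. Switching \<open>t\<close> pairs of edges, one from either part, yields a graph with a cut of \<open>2 t\<close> edges.
A graph on \<open>n\<close> vertices has at most \<open>n\<close> edges that meet every nonempty cut, and a cut is determined by
its intersection with them; so there are few cuts to undo, and the probability is at most \<open>(2 t + 1) / 4\<^sup>t\<close>
for every fixed \<open>t\<close> and large \<open>n\<close>.
\<close>

section \<open>Graphs as sets of edges\<close>

definition closed_in :: "'a set set \<Rightarrow> 'a set \<Rightarrow> bool" where
  "closed_in E A \<longleftrightarrow> (\<forall>e\<in>E. e \<subseteq> A \<or> e \<inter> A = {})"

definition cut_edges :: "'a set set \<Rightarrow> 'a set \<Rightarrow> 'a set set" where
  "cut_edges E A = {e \<in> E. \<not> e \<subseteq> A \<and> e \<inter> A \<noteq> {}}"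

text \<open>Minimality among nonempty closed sets replaces paths, so that connectivity arguments
  only compare closed sets. The ground set is not a parameter: a singleton outside it qualifies as
  well, hence the condition \<open>S \<subseteq> V\<close> wherever components are
  quantified.\<close>

definition component_set :: "'a set set \<Rightarrow> 'a set \<Rightarrow> bool" where
  "component_set E S \<longleftrightarrow> S \<noteq> {} \<and> closed_in E S \<and>
     (\<forall>T\<subseteq>S. closed_in E T \<longrightarrow> T = {} \<or> T = S)"

definition deg :: "'a set set \<Rightarrow> 'a \<Rightarrow> nat" where
  "deg E v = card {e \<in> E. v \<in> e}"

definition pairs :: "'a set \<Rightarrow> 'a set set" where
  "pairs V = {e. e \<subseteq> V \<and> card e = 2}"

definition realizations :: "'a set \<Rightarrow> ('a \<Rightarrow> nat) \<Rightarrow> 'a set set set" where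
  "realizations V d = {E. E \<subseteq> pairs V \<and> (\<forall>v\<in>V. deg E v = d v)}"

lemma edgeE:
  assumes "E \<subseteq> pairs V" "e \<in> E"
  obtains a b where "e = {a, b}" "a \<noteq> b" "a \<in> V" "b \<in> V"
proof -
  have "card e = 2" "e \<subseteq> V" using assms by (auto simp: pairs_def)
  then show ?thesis using that by (auto simp: card_2_iff)
qed

lemma cut_edges_empty_iff: "cut_edges E A = {} \<longleftrightarrow> closed_in E A"
  by (auto simp: cut_edges_def closed_in_def)

lemma finite_pairs: "finite V \<Longrightarrow> finite (pairs V)"
  by (rule finite_subset[of _ "Pow V"]) (auto simp: pairs_def)

lemma finite_realizations: "finite V \<Longrightarrow> finite (realizations V d)"
  by (rule finite_subset[of _ "Pow (pairs V)"]) (auto simp: realizations_def finite_pairs)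

lemma finite_realization: "finite V \<Longrightarrow> E \<in> realizations V d \<Longrightarrow> finite E"
  using finite_pairs finite_subset unfolding realizations_def by blast

lemma closed_in_Int: "closed_in E A \<Longrightarrow> closed_in E B \<Longrightarrow> closed_in E (A \<inter> B)"
  unfolding closed_in_def by blast

lemma closed_in_Un: "closed_in E A \<Longrightarrow> closed_in E B \<Longrightarrow> closed_in E (A \<union> B)"
  unfolding closed_in_def by blast

lemma closed_in_Diff: "closed_in E A \<Longrightarrow> closed_in E B \<Longrightarrow> closed_in E (A - B)"
  unfolding closed_in_def by blast

lemma closed_in_ground: "E \<subseteq> pairs V \<Longrightarrow> closed_in E V"
  unfolding closed_in_def pairs_def by blast

lemma component_sets_disjoint:
  assumes "component_set E S" "component_set E T" "S \<noteq> T"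
  shows "S \<inter> T = {}"
proof -
  have "closed_in E (S \<inter> T)"
    by (rule closed_in_Int) (use assms component_set_def in blast)+
  then have "S \<inter> T = {} \<or> S \<inter> T = S" "S \<inter> T = {} \<or> S \<inter> T = T"
    using assms(1,2) by (simp_all add: component_set_def)
  then show ?thesis using assms(3) by blast
qed

lemma component_set_exists:
  assumes "finite A" "A \<noteq> {}" "closed_in E A"
  obtains S where "S \<subseteq> A" "component_set E S"
proof -
  let ?F = "{S. S \<subseteq> A \<and> S \<noteq> {} \<and> closed_in E S}"
  have "finite ?F" by (rule finite_subset[of _ "Pow A"]) (auto simp: assms)
  moreover have "?F \<noteq> {}" using assms by blast
  ultimately obtain S where S: "S \<in> ?F" "\<forall>T\<in>?F. T \<subseteq> S \<longrightarrow> S = T"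
    by (elim finite_has_minimal[THEN bexE])
  show ?thesis
  proof (rule that)
    show "S \<subseteq> A" using S by blast
    show "component_set E S" unfolding component_set_def
    proof (intro conjI allI impI)
      fix T assume "T \<subseteq> S" "closed_in E T"
      then show "T = {} \<or> T = S" using S by blast
    qed (use S in auto)
  qed
qed

lemma sum_deg:
  assumes "finite E" "finite A"
  shows "(\<Sum>v\<in>A. deg E v) = (\<Sum>e\<in>E. card (e \<inter> A))"
proof -
  have "(\<Sum>v\<in>A. deg E v) = (\<Sum>v\<in>A. \<Sum>e\<in>E. if v \<in> e then 1 else 0)"
    by (intro sum.cong refl) (simp add: assms deg_def sum.If_cases Int_def)
  also have "\<dots> = (\<Sum>e\<in>E. \<Sum>v\<in>A. if v \<in> e then 1 else 0)" by (rule sum.swap)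
  also have "\<dots> = (\<Sum>e\<in>E. card (e \<inter> A))"
    by (intro sum.cong refl) (simp add: assms sum.If_cases Int_commute)
  finally show ?thesis .
qed

lemma sum_deg_cut:
  assumes V: "finite V" "E \<subseteq> pairs V" and A: "A \<subseteq> V"
  shows "(\<Sum>v\<in>A. deg E v) = 2 * card {e\<in>E. e \<subseteq> A} + card (cut_edges E A)"
proof -
  have fin: "finite E" "finite A"
    using assms finite_pairs finite_subset by blast+
  have "(\<Sum>v\<in>A. deg E v) = (\<Sum>e\<in>E. card (e \<inter> A))" by (rule sum_deg) fact+
  also have "\<dots> = (\<Sum>e\<in>E. (if e \<subseteq> A then 2 else 0) + (if e \<in> cut_edges E A then 1 else 0))"
  proof (rule sum.cong[OF refl])
    fix e assume e: "e \<in> E"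
    then obtain a b where ab: "e = {a, b}" "a \<noteq> b"
      using V(2) by (auto simp: pairs_def card_2_iff)
    then show "card (e \<inter> A) = (if e \<subseteq> A then 2 else 0) + (if e \<in> cut_edges E A then 1 else 0)"
      using e by (cases "a \<in> A"; cases "b \<in> A") (auto simp: cut_edges_def)
  qed
  also have "\<dots> = 2 * card {e\<in>E. e \<subseteq> A} + card (cut_edges E A)"
  proof -
    have "E \<inter> cut_edges E A = cut_edges E A" by (auto simp: cut_edges_def)
    then show ?thesis
      using fin by (simp add: sum.distrib sum.If_cases Int_def)
  qed
  finally show ?thesis .
qed

text \<open>Serves both operations on graphs below: the switching replaces two edges by two, the
  move three by three, and at each vertex as many edges come as go.\<close>

lemma deg_exchange:
  assumes "finite E" "finite Y" "X \<subseteq> E" "Y \<inter> (E - X) = {}"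
    and "(\<Sum>e\<in>X. of_bool (v \<in> e)) = (\<Sum>e\<in>Y. of_bool (v \<in> e) :: nat)"
  shows "deg (E - X \<union> Y) v = deg E v"
proof -
  have deg: "deg F v = (\<Sum>e\<in>F. of_bool (v \<in> e))" if "finite F" for F :: "'a set set"
    using that by (simp add: deg_def of_bool_def sum.If_cases Int_def)
  have "(\<Sum>e\<in>E - X \<union> Y. of_bool (v \<in> e) :: nat)
      = (\<Sum>e\<in>E - X. of_bool (v \<in> e)) + (\<Sum>e\<in>Y. of_bool (v \<in> e))"
    using assms by (intro sum.union_disjoint) auto
  also have "\<dots> = (\<Sum>e\<in>E. of_bool (v \<in> e))"
    using assms sum.subset_diff[of X E "\<lambda>e. of_bool (v \<in> e) :: nat"] by simp
  finally show ?thesis using deg assms by simp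
qed

lemma neighbours_as_edges:
  assumes "E \<subseteq> pairs V"
  shows "{e\<in>E. x \<in> e} = (\<lambda>y. {x, y}) ` {y. {x, y} \<in> E}"
proof (intro set_eqI iffI)
  fix e assume "e \<in> {e\<in>E. x \<in> e}"
  moreover from this obtain y where "e = {x, y}"
    using assms by (auto simp: pairs_def card_2_iff)
  ultimately show "e \<in> (\<lambda>y. {x, y}) ` {y. {x, y} \<in> E}" by blast
qed auto

lemma card_neighbours:
  assumes "E \<subseteq> pairs V"
  shows "card {y. {x, y} \<in> E} = deg E x"
proof -
  have "inj_on (\<lambda>y. {x, y}) {y. {x, y} \<in> E}"
    by (auto simp: inj_on_def doubleton_eq_iff)
  then show ?thesis
    by (simp add: deg_def neighbours_as_edges[OF assms] card_image)
qed

lemma neighbours_subset: "E \<subseteq> pairs V \<Longrightarrow> {y. {x, y} \<in> E} \<subseteq> V"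
  by (auto simp: pairs_def)

lemma distinct_ends: "E \<subseteq> pairs V \<Longrightarrow> {x, y} \<in> E \<Longrightarrow> x \<noteq> y"
  by (auto simp: pairs_def)

section \<open>Counting small cuts\<close>

lemma closed_in_sym_diff:
  assumes "closed_in E A" "closed_in E B"
  shows "closed_in E ((A - B) \<union> (B - A))"
  by (intro closed_in_Un closed_in_Diff assms)

text \<open>Symmetric difference with \<open>A0\<close> exchanges the sets that \<open>e\<close> cuts with those it does not cut.\<close>

lemma card_closed_insert:
  assumes "finite V" "A0 \<subseteq> V" "closed_in T A0" "\<not> closed_in {e} A0"
  shows "2 * card {A. A \<subseteq> V \<and> closed_in (insert e T) A} \<le> card {A. A \<subseteq> V \<and> closed_in T A}"
proof -
  let ?N = "{A. A \<subseteq> V \<and> closed_in (insert e T) A}"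
  let ?f = "\<lambda>A. (A - A0) \<union> (A0 - A)"
  have fin: "finite {A. A \<subseteq> V \<and> closed_in T A}"
    by (rule finite_subset[of _ "Pow V"]) (auto simp: assms)
  have "inj_on ?f ?N" by (rule inj_onI) blast
  moreover have "?N \<inter> ?f ` ?N = {}"
  proof -
    have "\<not> closed_in {e} (?f A)" if "closed_in {e} A" for A
    proof
      assume "closed_in {e} (?f A)"
      then have "closed_in {e} ((?f A - A) \<union> (A - ?f A))"
        using that by (rule closed_in_sym_diff)
      moreover have "(?f A - A) \<union> (A - ?f A) = A0" by blast
      ultimately show False using assms by simp
    qed
    moreover have "closed_in {e} A" if "A \<in> ?N" for A
      using that by (simp add: closed_in_def)
    ultimately show ?thesis by blast
  qed
  moreover have "?N \<union> ?f ` ?N \<subseteq> {A. A \<subseteq> V \<and> closed_in T A}"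
  proof -
    have *: "closed_in T A" if "A \<in> ?N" for A
      using that by (simp add: closed_in_def)
    have "?f A \<subseteq> V \<and> closed_in T (?f A)" if "A \<in> ?N" for A
      using that * assms(2,3) closed_in_sym_diff by blast
    then show ?thesis using * by blast
  qed
  moreover have "finite ?N" by (rule finite_subset[of _ "Pow V"]) (auto simp: assms)
  ultimately have "card ?N + card ?N \<le> card {A. A \<subseteq> V \<and> closed_in T A}"
    by (metis (no_types, lifting) card_Un_disjoint card_image card_mono fin finite_imageI)
  then show ?thesis by simp
qed

text \<open>\<open>T\<close> plays the role of a spanning forest. By
  \<open>card_closed_insert\<close>, adding an edge that crosses some \<open>T\<close>-closed set at
  least halves the number of closed sets. There are \<open>2 ^ card V\<close> of them for
  \<open>T = {}\<close> and always at least one, so a maximal \<open>T\<close> obtained in this way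
  has at most \<open>card V\<close> edges and leaves no edge of \<open>E\<close> to add.\<close>

lemma small_cut_basis:
  assumes "finite V" "finite E"
  obtains T where "T \<subseteq> E" "card T \<le> card V"
    "\<And>A. A \<subseteq> V \<Longrightarrow> closed_in T A \<Longrightarrow> closed_in E A"
proof -
  let ?N = "\<lambda>T. {A. A \<subseteq> V \<and> closed_in T A}"
  let ?F = "{T. T \<subseteq> E \<and> 2 ^ card T * card (?N T) \<le> 2 ^ card V}"
  have fin: "finite (?N T)" for T :: "'a set set"
    by (rule finite_subset[of _ "Pow V"]) (auto simp: assms)
  have "finite ?F" by (rule finite_subset[of _ "Pow E"]) (auto simp: assms)
  moreover have "{} \<in> ?F"
    using assms by (simp add: closed_in_def card_Pow flip: Pow_def)
  then have "?F \<noteq> {}" by (metis empty_iff)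
  ultimately obtain T where T: "T \<in> ?F" "\<forall>U\<in>?F. T \<subseteq> U \<longrightarrow> T = U"
    by (elim finite_has_maximal[THEN bexE])
  show ?thesis
  proof (rule that)
    show "T \<subseteq> E" using T by blast
    have "?N T \<noteq> {}" by (auto simp: closed_in_def)
    then have "card (?N T) \<ge> 1" using fin by (simp add: Suc_leI card_gt_0_iff)
    then have "(2::nat) ^ card T \<le> 2 ^ card T * card (?N T)" by simp
    also have "\<dots> \<le> 2 ^ card V" using T by blast
    finally show "card T \<le> card V" by simp
  next
    fix A assume A: "A \<subseteq> V" "closed_in T A"
    show "closed_in E A"
    proof (rule ccontr)
      assume "\<not> closed_in E A"
      then obtain e where e: "e \<in> E" "\<not> closed_in {e} A" by (auto simp: closed_in_def)
      then have "e \<notin> T" using A by (auto simp: closed_in_def)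
      then have "2 ^ card (insert e T) * card (?N (insert e T)) = 2 ^ card T * (2 * card (?N (insert e T)))"
        using finite_subset[of T E] T assms(2) by simp
      also have "\<dots> \<le> 2 ^ card T * card (?N T)"
        using card_closed_insert[OF assms(1) A e(2)] by simp
      also have "\<dots> \<le> 2 ^ card V" using T by blast
      finally have "insert e T \<in> ?F" using e T by blast
      then show False using T \<open>e \<notin> T\<close> by blast
    qed
  qed
qed

text \<open>Termwise: for \<open>j <= k <= n\<close>, the quotient of \<open>fact k\<close> by
  \<open>fact j\<close> is at most \<open>k ^ (k - j) <= n ^ (k - j)\<close>, and
  \<open>fact j * (n choose j) <= n ^ j\<close>.\<close>

lemma sum_binomial_le:
  assumes "k \<le> n"
  shows "fact k * (\<Sum>j\<le>k. n choose j) \<le> (k + 1) * n ^ k"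
proof -
  have "fact k * (n choose j) \<le> n ^ k" if "j \<le> k" for j
  proof -
    have "fact k * (n choose j) \<le> k ^ (k - j) * (fact j * (n choose j))"
    proof -
      have "fact k = fact k div fact j * (fact j :: nat)"
        using that by (simp add: fact_dvd)
      moreover have "fact k div fact j \<le> k ^ (k - j)"
        using fact_div_fact_le_pow[of "k - j" k] that by simp
      ultimately have "fact k \<le> k ^ (k - j) * fact j"
        by (metis mult_le_mono1)
      then show ?thesis by (metis mult.assoc mult_le_mono1)
    qed
    also have "fact j * (n choose j) \<le> n ^ j"
    proof (cases "j \<le> n")
      case True
      have "(n choose j) * fact j = fact n div fact (n - j)"
        using binomial_fact_lemma[OF True] by (metis fact_nonzero mult.assoc mult.commute nonzero_mult_div_cancel_left)
      also have "\<dots> \<le> n ^ j" by (rule fact_div_fact_le_pow[OF True])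
      finally show ?thesis by (simp add: mult.commute)
    qed (simp add: binomial_eq_0)
    also have "k ^ (k - j) * n ^ j \<le> n ^ (k - j) * n ^ j"
      using assms by (intro mult_right_mono power_mono) auto
    also have "\<dots> = n ^ k" using that by (simp flip: power_add)
    finally show ?thesis by simp
  qed
  then have "(\<Sum>j\<le>k. fact k * (n choose j)) \<le> (\<Sum>j\<le>k. n ^ k)"
    by (intro sum_mono) auto
  then show ?thesis by (simp add: sum_distrib_left)
qed

text \<open>With \<open>T\<close> from \<open>small_cut_basis\<close>, a cut is determined by its
  trace on \<open>T\<close>: if two cuts agree there, the symmetric difference of their vertex sets
  is \<open>T\<close>-closed, hence \<open>E\<close>-closed, and so the cuts agree everywhere. The
  trace has at most \<open>k\<close> of the at most \<open>card V\<close> edges of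
  \<open>T\<close>.\<close>

lemma card_cuts_le:
  assumes "finite V" "E \<subseteq> pairs V"
  shows "card {F. \<exists>A\<subseteq>V. F = cut_edges E A \<and> card F = k} \<le> (\<Sum>j\<le>k. card V choose j)"
proof -
  have finE: "finite E" using assms finite_pairs finite_subset by blast
  obtain T where T: "T \<subseteq> E" "card T \<le> card V"
    "\<And>A. A \<subseteq> V \<Longrightarrow> closed_in T A \<Longrightarrow> closed_in E A"
    using small_cut_basis[OF assms(1) finE] by blast
  let ?C = "{F. \<exists>A\<subseteq>V. F = cut_edges E A \<and> card F = k}"
  have finT: "finite T" using T(1) finE finite_subset by blast
  have "inj_on (\<lambda>F. F \<inter> T) ?C"
  proof (rule inj_onI)
    fix F F' assume "F \<in> ?C" "F' \<in> ?C" and eq: "F \<inter> T = F' \<inter> T"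
    then obtain A B where AB: "A \<subseteq> V" "B \<subseteq> V" "F = cut_edges E A" "F' = cut_edges E B" by blast
    let ?D = "(A - B) \<union> (B - A)"
    \<comment> \<open>A two-element edge crosses \<open>?D\<close> exactly when it crosses one of
      \<open>A\<close> and \<open>B\<close> but not the other.\<close>
    have "e \<subseteq> ?D \<or> e \<inter> ?D = {}" if eT: "e \<in> T" for e
    proof -
      have "e \<in> cut_edges E A \<longleftrightarrow> e \<in> cut_edges E B" using eT eq AB by blast
      moreover obtain a b where "e = {a, b}"
        using edgeE[OF assms(2), of e] eT T(1) by blast
      ultimately show ?thesis
        using eT T(1) by (auto simp: cut_edges_def)
    qed
    then have "closed_in E ?D" using T(3)[of ?D] AB by (auto simp: closed_in_def)
    then show "F = F'" unfolding AB cut_edges_def closed_in_def by blast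
  qed
  then have "card ?C = card ((\<lambda>F. F \<inter> T) ` ?C)" by (simp add: card_image)
  also have "\<dots> \<le> card (\<Union>j\<in>{..k}. {U. U \<subseteq> T \<and> card U = j})"
  proof (rule card_mono)
    show "finite (\<Union>j\<in>{..k}. {U. U \<subseteq> T \<and> card U = j})"
      by (rule finite_subset[of _ "Pow T"]) (auto simp: finT)
    show "(\<lambda>F. F \<inter> T) ` ?C \<subseteq> (\<Union>j\<in>{..k}. {U. U \<subseteq> T \<and> card U = j})"
    proof clarsimp
      fix A assume "k = card (cut_edges E A)"
      then show "card (cut_edges E A \<inter> T) \<le> card (cut_edges E A)"
        using finE by (intro card_mono) (auto simp: cut_edges_def)
    qed
  qed
  also have "\<dots> \<le> (\<Sum>j\<le>k. card {U. U \<subseteq> T \<and> card U = j})" by (rule card_UN_le) simp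
  also have "\<dots> = (\<Sum>j\<le>k. card T choose j)" by (simp add: n_subsets[OF finT])
  also have "\<dots> \<le> (\<Sum>j\<le>k. card V choose j)" by (intro sum_mono binomial_right_mono T)
  finally show ?thesis .
qed

section \<open>Dense case: switching across a balanced cut\<close>

definition balanced :: "'a set \<Rightarrow> ('a \<Rightarrow> nat) \<Rightarrow> 'a set \<Rightarrow> bool" where
  "balanced V d A \<longleftrightarrow> A \<subseteq> V \<and> sum d V \<le> 4 * sum d A \<and> sum d V \<le> 4 * sum d (V - A)"

text \<open>The cut is recorded, not the vertex set defining it: a graph with many components has
exponentially many balanced sets with the same cut.\<close>

definition balanced_cuts :: "'a set \<Rightarrow> ('a \<Rightarrow> nat) \<Rightarrow> nat \<Rightarrow> ('a set set \<times> 'a set set) set" where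
  "balanced_cuts V d k = {(E, F). E \<in> realizations V d \<and> card F = 2 * k \<and>
     (\<exists>A. balanced V d A \<and> F = cut_edges E A)}"

text \<open>Orienting edges towards the larger degree bounds out-degrees by \<open>sqrt (sum d V)\<close>, so that only few
pairs of edges cannot be switched, even in the presence of vertices of linear degree.\<close>

definition ascending :: "('a \<Rightarrow> nat) \<Rightarrow> 'a set set \<Rightarrow> 'a set \<Rightarrow> ('a \<times> 'a) set" where
  "ascending d E A = {(x, y). {x, y} \<in> E \<and> x \<in> A \<and> y \<in> A \<and> d x \<le> d y}"

section \<open>Switching a pair of edges across a vertex set\<close>

lemma switch_realization:
  assumes E: "E \<in> realizations V d" and V: "finite V"
    and e: "{x, y} \<in> E" "{u, v} \<in> E" "{x, v} \<notin> E" "{y, u} \<notin> E" "{x, y} \<inter> {u, v} = {}"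
  shows "E - {{x, y}, {u, v}} \<union> {{x, v}, {y, u}} \<in> realizations V d"
proof -
  have sub: "E \<subseteq> pairs V" using E by (simp add: realizations_def)
  have V': "x \<in> V" "y \<in> V" "u \<in> V" "v \<in> V" and ne: "x \<noteq> y" "u \<noteq> v"
    using sub e(1,2) by (auto simp: pairs_def)
  have "deg (E - {{x, y}, {u, v}} \<union> {{x, v}, {y, u}}) w = deg E w" for w
  proof (rule deg_exchange)
    have two: "(\<Sum>e\<in>{a, b}. g e) = g a + g b" if "a \<noteq> b" for a b and g :: "'a set \<Rightarrow> nat"
      using that by simp
    have ne': "{x, y} \<noteq> {u, v}" "{x, v} \<noteq> {y, u}"
      using e(5) ne by (auto simp: doubleton_eq_iff)
    show "(\<Sum>e\<in>{{x, y}, {u, v}}. of_bool (w \<in> e)) = (\<Sum>e\<in>{{x, v}, {y, u}}. of_bool (w \<in> e) :: nat)"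
      unfolding two[OF ne'(1)] two[OF ne'(2)] using e(5) ne by auto
  qed (use e V sub finite_pairs finite_subset in auto)
  moreover have "{x, v} \<in> pairs V" "{y, u} \<in> pairs V"
    using V' ne e(5) by (auto simp: pairs_def)
  ultimately show ?thesis using E by (auto simp: realizations_def)
qed

lemma switch_cut_edges:
  assumes "x \<in> A" "y \<in> A" "u \<notin> A" "v \<notin> A"
  shows "cut_edges (E - {{x, y}, {u, v}} \<union> {{x, v}, {y, u}}) A = cut_edges E A \<union> {{x, v}, {y, u}}"
  using assms by (auto simp: cut_edges_def)

lemma finite_ascending: "finite V \<Longrightarrow> A \<subseteq> V \<Longrightarrow> finite (ascending d E A)"
  by (rule finite_subset[of _ "V \<times> V"]) (auto simp: ascending_def)

lemma card_ascending:
  assumes "finite V" "A \<subseteq> V" "E \<subseteq> pairs V"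
  shows "card {e\<in>E. e \<subseteq> A} \<le> card (ascending d E A)"
proof -
  have "{e\<in>E. e \<subseteq> A} \<subseteq> (\<lambda>(x, y). {x, y}) ` ascending d E A"
  proof
    fix e assume e: "e \<in> {e\<in>E. e \<subseteq> A}"
    then obtain a b where ab: "e = {a, b}" using edgeE[OF assms(3)] by blast
    show "e \<in> (\<lambda>(x, y). {x, y}) ` ascending d E A"
    proof (cases "d a \<le> d b")
      case True
      then have "(a, b) \<in> ascending d E A" using e ab by (auto simp: ascending_def)
      then show ?thesis using ab by force
    next
      case False
      then have "(b, a) \<in> ascending d E A" using e ab by (auto simp: ascending_def insert_commute)
      then show ?thesis using ab by force
    qed
  qed
  then show ?thesis
    by (rule surj_card_le[OF finite_ascending[OF assms(1,2)]])
qed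

text \<open>If \<open>x\<close> has \<open>k\<close> ascending neighbours, then
  \<open>k <= d x\<close>, and each of them has degree at least \<open>d x\<close>. Hence
  \<open>k^2 <= k * d x\<close>, which is at most the sum of their degrees.\<close>

lemma ascending_outdegree:
  assumes E: "E \<in> realizations V d" and V: "finite V" "x \<in> V"
  shows "real (card {y. {x, y} \<in> E \<and> d x \<le> d y}) \<le> sqrt (real (sum d V))"
proof -
  let ?Y = "{y. {x, y} \<in> E \<and> d x \<le> d y}"
  have sub: "E \<subseteq> pairs V" using E by (simp add: realizations_def)
  have Y: "?Y \<subseteq> V" using neighbours_subset[OF sub] by blast
  have "card ?Y \<le> card {y. {x, y} \<in> E}"
    by (rule card_mono) (use finite_subset[OF neighbours_subset[OF sub] V(1)] in auto)
  also have "\<dots> = d x" using card_neighbours[OF sub] E V by (simp add: realizations_def)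
  finally have "card ?Y * card ?Y \<le> card ?Y * d x" by simp
  also have "\<dots> = (\<Sum>y\<in>?Y. d x)" by simp
  also have "\<dots> \<le> (\<Sum>y\<in>?Y. d y)" by (rule sum_mono) auto
  also have "\<dots> \<le> sum d V" by (rule sum_mono2) (use V Y in auto)
  finally have "real (card ?Y * card ?Y) \<le> real (sum d V)" by (rule of_nat_mono)
  then have "(real (card ?Y))\<^sup>2 \<le> real (sum d V)"
    unfolding power2_eq_square of_nat_mult .
  then show ?thesis by (rule real_le_rsqrt)
qed

lemma card_ordered_pairs:
  assumes "F \<subseteq> pairs V" "finite F"
  shows "finite {(x, v). {x, v} \<in> F}" "card {(x, v). {x, v} \<in> F} \<le> 2 * card F"
proof -
  let ?f = "\<lambda>e. {(x, v). {x, v} = e}"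
  have f: "finite (?f e) \<and> card (?f e) \<le> 2" if e: "e \<in> F" for e
  proof -
    obtain a b where "e = {a, b}" using edgeE[OF assms(1) e] by blast
    then have sub: "?f e \<subseteq> {(a, b), (b, a)}" by (auto simp: doubleton_eq_iff)
    then have "card (?f e) \<le> card {(a, b), (b, a)}" by (intro card_mono) auto
    also have "\<dots> \<le> 2" by (simp add: card_insert_le_m1)
    finally show ?thesis using sub finite_subset by blast
  qed
  have eq: "{(x, v). {x, v} \<in> F} = (\<Union>e\<in>F. ?f e)" by auto
  show "finite {(x, v). {x, v} \<in> F}" unfolding eq using f assms by blast
  have "card (\<Union>e\<in>F. ?f e) \<le> (\<Sum>e\<in>F. card (?f e))" by (rule card_UN_le) fact
  also have "\<dots> \<le> (\<Sum>e\<in>F. 2)" using f by (intro sum_mono) auto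
  finally show "card {(x, v). {x, v} \<in> F} \<le> 2 * card F" unfolding eq by simp
qed

lemma card_UN_image_le:
  fixes B :: "'a \<Rightarrow> 'b set" and C :: "'a \<Rightarrow> 'c set" and b c :: real
  assumes "finite P" "\<And>p. p \<in> P \<Longrightarrow> finite (B p) \<and> real (card (B p)) \<le> b"
    and "\<And>p. p \<in> P \<Longrightarrow> finite (C p) \<and> real (card (C p)) \<le> c" and "b \<ge> 0" "c \<ge> 0"
  shows "real (card (\<Union>p\<in>P. f p ` (B p \<times> C p))) \<le> real (card P) * (b * c)"
proof -
  have "card (\<Union>p\<in>P. f p ` (B p \<times> C p)) \<le> (\<Sum>p\<in>P. card (f p ` (B p \<times> C p)))"
    by (rule card_UN_le) fact
  also have "real \<dots> \<le> (\<Sum>p\<in>P. b * c)"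
    unfolding of_nat_sum
  proof (rule sum_mono)
    fix p assume p: "p \<in> P"
    have "real (card (f p ` (B p \<times> C p))) \<le> real (card (B p \<times> C p))"
      using assms(2,3)[OF p] by (intro of_nat_mono card_image_le) auto
    also have "\<dots> = real (card (B p)) * real (card (C p))" by (simp add: card_cartesian_product)
    also have "\<dots> \<le> b * c" using assms(2,3)[OF p] assms(4) by (intro mult_mono) auto
    finally show "real (card (f p ` (B p \<times> C p))) \<le> b * c" .
  qed
  finally show ?thesis by simp
qed

definition switchings :: "('a \<Rightarrow> nat) \<Rightarrow> 'a set set \<Rightarrow> 'a set \<Rightarrow> 'a set \<Rightarrow> (('a \<times> 'a) \<times> ('a \<times> 'a)) set" where
  "switchings d E A B = {((x, y), (u, v)). (x, y) \<in> ascending d E A \<and> (u, v) \<in> ascending d E B \<and>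
     {x, v} \<notin> E \<and> {y, u} \<notin> E}"

text \<open>A pair of ascending edges, one from either side, is blocked only if
  \<open>{x, v}\<close> or \<open>{y, u}\<close> is already an edge, and such an edge crosses the
  cut. Fixing it with an orientation allows at most \<open>2 * card (cut_edges E A)\<close> choices;
  of the two remaining vertices one is an ascending neighbour of a known vertex and the other a
  neighbour. The two kinds of blocking give the factor 4.\<close>

lemma card_switchings:
  assumes E: "E \<in> realizations V d" and V: "finite V" and A: "A \<subseteq> V"
  shows "real (card (ascending d E A)) * real (card (ascending d E (V - A)))
    \<le> real (card (switchings d E A (V - A)))
      + 4 * real (card (cut_edges E A)) * sqrt (real (sum d V)) * real (card V)"
proof -
  let ?B = "V - A" and ?F = "cut_edges E A" and ?s = "sqrt (real (sum d V))"
  let ?P = "{(x, v). {x, v} \<in> ?F}"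
  have sub: "E \<subseteq> pairs V" using E by (simp add: realizations_def)
  have finE: "finite E" using E V finite_realization by blast
  have F: "?F \<subseteq> pairs V" "finite ?F" using sub finE by (auto simp: cut_edges_def)
  note P = card_ordered_pairs[OF F]
  have PV: "x \<in> V" "v \<in> V" if "(x, v) \<in> ?P" for x v
    using that F(1) by (auto simp: pairs_def)
  let ?O = "\<lambda>x. {y. {x, y} \<in> E \<and> d x \<le> d y}" and ?N = "\<lambda>x. {y. {x, y} \<in> E}"
  have finN: "finite (?N x)" for x
    by (rule finite_subset[OF neighbours_subset[OF sub] V])
  have O: "finite (?O x) \<and> real (card (?O x)) \<le> ?s" if "x \<in> V" for x
    by (intro conjI ascending_outdegree[OF E V that] finite_subset[OF _ finN[of x]]) blast
  have N: "finite (?N x) \<and> real (card (?N x)) \<le> real (card V)" for x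
    using finN card_mono[OF V neighbours_subset[OF sub]] by simp
  \<comment> \<open>The blocking edge is \<open>p\<close>: in \<open>?X1\<close> it is
    \<open>(x, v)\<close>, and \<open>y\<close> ascends from \<open>x\<close>; in \<open>?X2\<close>
    it is \<open>(y, u)\<close>, and \<open>v\<close> ascends from \<open>u\<close>.\<close>
  let ?X1 = "\<Union>p\<in>?P. (\<lambda>(y, u). ((fst p, y), (u, snd p))) ` (?O (fst p) \<times> ?N (snd p))"
  let ?X2 = "\<Union>p\<in>?P. (\<lambda>(v, x). ((x, fst p), (snd p, v))) ` (?O (snd p) \<times> ?N (fst p))"
  have s0: "?s \<ge> 0" by (simp add: sum_nonneg)
  have fin: "finite ?X1" "finite ?X2"
    by (intro finite_UN_I[OF P(1)] finite_imageI finite_cartesian_product; use O N PV in auto)+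
  have X1: "real (card ?X1) \<le> real (card ?P) * (?s * real (card V))"
    by (rule card_UN_image_le) (use O N P(1) PV s0 in auto)
  have X2: "real (card ?X2) \<le> real (card ?P) * (?s * real (card V))"
    by (rule card_UN_image_le) (use O N P(1) PV s0 in auto)
  have finS: "finite (switchings d E A ?B)"
    by (rule finite_subset[of _ "ascending d E A \<times> ascending d E ?B"])
       (use finite_ascending[OF V] A in \<open>auto simp: switchings_def\<close>)
  have "ascending d E A \<times> ascending d E ?B \<subseteq> switchings d E A ?B \<union> (?X1 \<union> ?X2)"
  proof
    fix q assume q: "q \<in> ascending d E A \<times> ascending d E ?B"
    obtain x y u v where xyuv: "q = ((x, y), u, v)" by (metis surj_pair)
    have xy: "(x, y) \<in> ascending d E A" and uv: "(u, v) \<in> ascending d E ?B"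
      using q xyuv by auto
    show "q \<in> switchings d E A ?B \<union> (?X1 \<union> ?X2)"
    proof (rule ccontr)
      assume "\<not> ?thesis"
      then have no: "((x, y), u, v) \<notin> ?X2" "((x, y), u, v) \<notin> ?X1" "((x, y), u, v) \<notin> switchings d E A ?B"
        unfolding xyuv by blast+
      have "{x, v} \<notin> E"
      proof
        assume "{x, v} \<in> E"
        then have "(x, v) \<in> ?P" using xy uv by (auto simp: cut_edges_def ascending_def)
        moreover have "(y, u) \<in> ?O x \<times> ?N v"
          using xy uv by (auto simp: ascending_def insert_commute)
        ultimately have "((x, y), u, v) \<in> ?X1" by force
        with no show False by blast
      qed
      moreover have "{y, u} \<notin> E"
      proof
        assume "{y, u} \<in> E"
        then have "(y, u) \<in> ?P" using xy uv by (auto simp: cut_edges_def ascending_def)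
        moreover have "(v, x) \<in> ?O u \<times> ?N y"
          using xy uv by (auto simp: ascending_def insert_commute)
        ultimately have "((x, y), u, v) \<in> ?X2" by force
        with no show False by blast
      qed
      ultimately show False
        using xy uv no(3) by (simp add: switchings_def)
    qed
  qed
  then have "card (ascending d E A \<times> ascending d E ?B) \<le> card (switchings d E A ?B \<union> (?X1 \<union> ?X2))"
    by (rule card_mono[rotated]) (use fin finS in blast)
  also have "\<dots> \<le> card (switchings d E A ?B) + (card ?X1 + card ?X2)"
    by (meson add_left_mono card_Un_le order_trans)
  finally have "real (card (ascending d E A)) * real (card (ascending d E ?B))
      \<le> real (card (switchings d E A ?B)) + (real (card ?X1) + real (card ?X2))"
    by (simp add: card_cartesian_product flip: of_nat_mult of_nat_add)
  also have "\<dots> \<le> real (card (switchings d E A ?B)) + 2 * (real (card ?P) * (?s * real (card V)))"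
    using X1 X2 by simp
  also have "\<dots> \<le> real (card (switchings d E A ?B)) + 2 * ((2 * real (card ?F)) * (?s * real (card V)))"
  proof -
    have "real (card ?P) \<le> 2 * real (card ?F)" using P(2) by linarith
    then show ?thesis
      using s0 by (intro add_left_mono mult_left_mono mult_right_mono) auto
  qed
  finally show ?thesis by (simp add: algebra_simps)
qed

section \<open>Counting realizations with a balanced cut of given size\<close>

lemma finite_balanced_cuts:
  assumes "finite V"
  shows "finite (balanced_cuts V d k)"
  by (rule finite_subset[of _ "Pow (pairs V) \<times> Pow (pairs V)"])
     (use finite_pairs[OF assms] in \<open>auto simp: balanced_cuts_def realizations_def cut_edges_def\<close>)

text \<open>Being balanced depends on the degrees alone, so \<open>A\<close> remains balanced, and
  its cut gains exactly the two new edges.\<close>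

lemma switch_balanced_cut:
  assumes V: "finite V" and EF: "(E, F) \<in> balanced_cuts V d k"
    and A: "balanced V d A" "F = cut_edges E A"
    and sw: "((x, y), (u, v)) \<in> switchings d E A (V - A)"
  shows "(E - {{x, y}, {u, v}} \<union> {{x, v}, {y, u}}, F \<union> {{x, v}, {y, u}}) \<in> balanced_cuts V d (Suc k)"
proof -
  have E: "E \<in> realizations V d" and F: "card F = 2 * k"
    using EF by (auto simp: balanced_cuts_def)
  have finF: "finite F" using finite_realization[OF V E] A(2) by (simp add: cut_edges_def)
  have xy: "{x, y} \<in> E" "{u, v} \<in> E" "{x, v} \<notin> E" "{y, u} \<notin> E"
    and side: "x \<in> A" "y \<in> A" "u \<notin> A" "v \<notin> A"
    using sw by (auto simp: switchings_def ascending_def)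
  have "{x, y} \<inter> {u, v} = {}" using side by auto
  note E' = switch_realization[OF E V xy this]
  have "x \<noteq> y" using distinct_ends[of E V x y] xy E by (auto simp: realizations_def)
  then have "{x, v} \<noteq> {y, u}" using side by (auto simp: doubleton_eq_iff)
  moreover have "{x, v} \<notin> F" "{y, u} \<notin> F" using xy A(2) by (auto simp: cut_edges_def)
  ultimately have "card (F \<union> {{x, v}, {y, u}}) = 2 * Suc k"
    using F finF by simp
  moreover have "F \<union> {{x, v}, {y, u}} = cut_edges (E - {{x, y}, {u, v}} \<union> {{x, v}, {y, u}}) A"
    using switch_cut_edges[OF side] A(2) by simp
  ultimately show ?thesis using E' A(1) unfolding balanced_cuts_def by blast
qed

text \<open>Write \<open>w\<close> for \<open>sum d V\<close>. Each side has degree sum at least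
  \<open>w / 4\<close> and a cut of \<open>2 * k\<close> edges, so it contains at least
  \<open>w / 8 - k >= w / 16\<close> edges; this gives \<open>w^2 / 256\<close> pairs. Since
  \<open>21 * t <= sqrt w\<close> and \<open>card V <= w / 200\<close>, at most
  \<open>8 / 4200 * w^2 <= w^2 / 512\<close> of them are blocked.\<close>

lemma card_switchings_balanced:
  assumes V: "finite V" and E: "E \<in> realizations V d" and A: "balanced V d A"
    and k: "card (cut_edges E A) = 2 * k" "k < t"
    and W: "200 * card V \<le> sum d V" "441 * t\<^sup>2 \<le> sum d V"
  shows "(real (sum d V))\<^sup>2 / 512 \<le> real (card (switchings d E A (V - A)))"
proof -
  define w where "w = real (sum d V)"
  let ?B = "V - A"
  have sub: "E \<subseteq> pairs V" and AV: "A \<subseteq> V"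
    using E A by (auto simp: realizations_def balanced_def)
  have cutB: "cut_edges E ?B = cut_edges E A"
    using sub by (auto simp: cut_edges_def pairs_def)
  have t: "(21 * real t)\<^sup>2 \<le> w"
    using W(2) unfolding w_def power2_eq_square by (simp flip: of_nat_mult of_nat_sum)
  have "real t \<le> (real t)\<^sup>2" by (cases t) (auto simp: power2_eq_square)
  moreover have "441 * (real t)\<^sup>2 \<le> w" using t by (simp add: power_mult_distrib)
  ultimately have "16 * real k \<le> w" using k(2) by linarith
  moreover have "w / 8 - real k \<le> real (card (ascending d E A'))"
    if "A' \<subseteq> V" "sum d V \<le> 4 * sum d A'" "card (cut_edges E A') = 2 * k" for A'
  proof -
    have "sum d A' = sum (deg E) A'"
      using E that(1) by (intro sum.cong) (auto simp: realizations_def)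
    then have "sum d A' \<le> 2 * card (ascending d E A') + 2 * k"
      using sum_deg_cut[OF V sub that(1)] card_ascending[OF V that(1) sub] that(3) by (metis (no_types, lifting) add_le_mono1 mult_le_mono2)
    then have "sum d V \<le> 8 * card (ascending d E A') + 8 * k" using that(2) by linarith
    then show ?thesis unfolding w_def by (simp flip: of_nat_sum)
  qed
  then have "w / 8 - real k \<le> real (card (ascending d E A))" "w / 8 - real k \<le> real (card (ascending d E ?B))"
    using A k(1) cutB by (auto simp: balanced_def)
  ultimately have "w / 16 \<le> real (card (ascending d E A))" "w / 16 \<le> real (card (ascending d E ?B))"
    by linarith+
  moreover have "w \<ge> 0" by (simp add: w_def sum_nonneg)
  ultimately have "w / 16 * (w / 16) \<le> real (card (ascending d E A)) * real (card (ascending d E ?B))"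
    by (intro mult_mono) auto
  also have "\<dots> \<le> real (card (switchings d E A ?B)) + 4 * real (2 * k) * sqrt w * real (card V)"
    using card_switchings[OF E V AV] k unfolding w_def by simp
  also have "4 * real (2 * k) * sqrt w * real (card V) \<le> w / 16 * (w / 32)"
  proof -
    have "real (200 * card V) \<le> w" unfolding w_def by (rule of_nat_mono[OF W(1)])
    then have cardV: "real (card V) \<le> w / 200" by simp
    have "21 * real t \<le> sqrt w" using t by (simp add: real_le_rsqrt)
    then have "8 * real k \<le> 8 / 21 * sqrt w" using k(2) by linarith
    then have "8 * real k * sqrt w * real (card V) \<le> (8 / 21 * sqrt w) * sqrt w * (w / 200)"
      by (rule mult_mono[OF mult_right_mono cardV]) (use \<open>w \<ge> 0\<close> in auto)
    also have "\<dots> = 8 / 4200 * (sqrt w * sqrt w) * w" by simp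
    also have "\<dots> = 8 / 4200 * (w * w)" using \<open>w \<ge> 0\<close> by simp
    also have "\<dots> \<le> 1 / 512 * (w * w)" using \<open>w \<ge> 0\<close> by (intro mult_right_mono) auto
    finally show ?thesis by simp
  qed
  finally show ?thesis unfolding w_def[symmetric] power2_eq_square by simp
qed

text \<open>Double counting. A switching leads to a pair with parameter \<open>Suc k\<close> in
  which the two new cut edges are marked and oriented, and \<open>h\<close> undoes it from this
  data. A cut of \<open>2 * Suc k\<close> edges has at most \<open>4 * Suc k\<close> oriented edges,
  and two are marked, whence the factor \<open>16 * (Suc k)^2\<close>.\<close>

lemma card_balanced_cuts_Suc:
  assumes V: "finite V" and k: "k < t"
    and W: "200 * card V \<le> sum d V" "441 * t\<^sup>2 \<le> sum d V"
  shows "real (card (balanced_cuts V d k)) * ((real (sum d V))\<^sup>2 / 512)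
    \<le> real (16 * (Suc k)\<^sup>2 * card (balanced_cuts V d (Suc k)))"
proof -
  let ?Q = "balanced_cuts V d"
  let ?P = "\<lambda>F. {(x, v). {x, v} \<in> (F :: 'a set set)}"
  \<comment> \<open>One set \<open>A p\<close> is fixed for every pair. It need not be recovered
    from the image, because undoing a switching uses only the two marked edges.\<close>
  have "\<forall>p\<in>?Q k. \<exists>A. balanced V d A \<and> snd p = cut_edges (fst p) A"
    by (auto simp: balanced_cuts_def)
  then obtain A where A: "\<And>p. p \<in> ?Q k \<Longrightarrow> balanced V d (A p) \<and> snd p = cut_edges (fst p) (A p)"
    by metis
  let ?S = "\<lambda>p. switchings d (fst p) (A p) (V - A p)"
  define g :: "('a set set \<times> 'a set set) \<times> ('a \<times> 'a) \<times> 'a \<times> 'a \<Rightarrow> _" where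
    "g = (\<lambda>((E, F), (x, y), (u, v)).
      ((E - {{x, y}, {u, v}} \<union> {{x, v}, {y, u}}, F \<union> {{x, v}, {y, u}}), (x, v), (y, u)))"
  define h :: "('a set set \<times> 'a set set) \<times> ('a \<times> 'a) \<times> 'a \<times> 'a \<Rightarrow> _" where
    "h = (\<lambda>((E, F), (x, v), (y, u)).
      ((E - {{x, v}, {y, u}} \<union> {{x, y}, {u, v}}, F - {{x, v}, {y, u}}), (x, y), (u, v)))"
  have finP: "finite (?P (snd p))" "card (?P (snd p)) \<le> 4 * Suc k" if "p \<in> ?Q (Suc k)" for p
  proof -
    have "snd p \<subseteq> pairs V" "card (snd p) = 2 * Suc k"
      using that by (auto simp: balanced_cuts_def realizations_def cut_edges_def)
    moreover have "finite (snd p)"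
      using calculation finite_pairs[OF V] finite_subset by blast
    ultimately show "finite (?P (snd p))" "card (?P (snd p)) \<le> 4 * Suc k"
      using card_ordered_pairs[of "snd p" V] by auto
  qed
  have real: "fst p \<in> realizations V d" "card (snd p) = 2 * k" if "p \<in> ?Q k" for p
    using that by (auto simp: balanced_cuts_def)
  have finS: "finite (?S p)" if "p \<in> ?Q k" for p
    by (rule finite_subset[of _ "(V \<times> V) \<times> V \<times> V"])
       (use A[OF that] V in \<open>auto simp: switchings_def ascending_def balanced_def\<close>)
  have inj: "inj_on g (Sigma (?Q k) ?S)"
  proof (rule inj_on_inverseI[of _ h])
    fix q assume "q \<in> Sigma (?Q k) ?S"
    then obtain E F x y u v where q: "q = ((E, F), (x, y), (u, v))" "(E, F) \<in> ?Q k"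
      and sw: "((x, y), (u, v)) \<in> switchings d E (A (E, F)) (V - A (E, F))" by auto
    have "F \<subseteq> E" using q(2) by (auto simp: balanced_cuts_def cut_edges_def)
    moreover have "{x, y} \<in> E" "{u, v} \<in> E" "{x, v} \<notin> E" "{y, u} \<notin> E"
      using sw by (auto simp: switchings_def ascending_def)
    ultimately show "h (g q) = q" unfolding q(1) g_def h_def by auto
  qed
  have sub: "g ` Sigma (?Q k) ?S \<subseteq> Sigma (?Q (Suc k)) (\<lambda>p. ?P (snd p) \<times> ?P (snd p))"
  proof
    fix r assume "r \<in> g ` Sigma (?Q k) ?S"
    then obtain E F x y u v where r: "r = g ((E, F), (x, y), (u, v))" and EF: "(E, F) \<in> ?Q k"
      and sw: "((x, y), (u, v)) \<in> switchings d E (A (E, F)) (V - A (E, F))"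
      by auto
    have "(E - {{x, y}, {u, v}} \<union> {{x, v}, {y, u}}, F \<union> {{x, v}, {y, u}}) \<in> ?Q (Suc k)"
      using switch_balanced_cut[OF V EF _ _ sw] A[OF EF] by simp
    then show "r \<in> Sigma (?Q (Suc k)) (\<lambda>p. ?P (snd p) \<times> ?P (snd p))"
      by (auto simp: g_def r)
  qed
  have finR: "finite (Sigma (?Q (Suc k)) (\<lambda>p. ?P (snd p) \<times> ?P (snd p)))"
    by (intro finite_SigmaI finite_balanced_cuts V finite_cartesian_product finP)
  have "real (card (?Q k)) * ((real (sum d V))\<^sup>2 / 512) = (\<Sum>p\<in>?Q k. (real (sum d V))\<^sup>2 / 512)"
    by simp
  also have "\<dots> \<le> (\<Sum>p\<in>?Q k. real (card (?S p)))"
    using A real by (intro sum_mono card_switchings_balanced[OF V _ _ _ k W]) auto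
  also have "\<dots> = real (card (Sigma (?Q k) ?S))"
    using finS by (simp add: card_SigmaI finite_balanced_cuts[OF V])
  also have "\<dots> \<le> real (card (Sigma (?Q (Suc k)) (\<lambda>p. ?P (snd p) \<times> ?P (snd p))))"
    using card_inj_on_le[OF inj sub finR] by simp
  also have "\<dots> = real (\<Sum>p\<in>?Q (Suc k). card (?P (snd p)) * card (?P (snd p)))"
    using finP by (simp add: card_SigmaI finite_balanced_cuts[OF V] card_cartesian_product)
  also have "\<dots> \<le> real (\<Sum>p\<in>?Q (Suc k). (4 * Suc k) * (4 * Suc k))"
    using finP by (intro of_nat_mono sum_mono mult_le_mono) auto
  also have "\<dots> = real (16 * (Suc k)\<^sup>2 * card (?Q (Suc k)))"
    by (simp add: power2_eq_square algebra_simps)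
  finally show ?thesis .
qed

lemma card_balanced_cuts_iterate:
  assumes V: "finite V" and W: "200 * card V \<le> sum d V" "441 * t\<^sup>2 \<le> sum d V"
  shows "k \<le> t \<Longrightarrow> real (card (balanced_cuts V d 0)) * ((real (sum d V))\<^sup>2 / 512) ^ k
    \<le> 16 ^ k * (fact k)\<^sup>2 * real (card (balanced_cuts V d k))"
proof (induction k)
  case (Suc k)
  let ?f = "(real (sum d V))\<^sup>2 / 512"
  have "real (card (balanced_cuts V d 0)) * ?f ^ Suc k
      = (real (card (balanced_cuts V d 0)) * ?f ^ k) * ?f" by simp
  also have "\<dots> \<le> (16 ^ k * (fact k)\<^sup>2 * real (card (balanced_cuts V d k))) * ?f"
    using Suc by (intro mult_right_mono) auto
  also have "\<dots> = 16 ^ k * (fact k)\<^sup>2 * (real (card (balanced_cuts V d k)) * ?f)" by simp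
  also have "\<dots> \<le> 16 ^ k * (fact k)\<^sup>2 * real (16 * (Suc k)\<^sup>2 * card (balanced_cuts V d (Suc k)))"
    using Suc by (intro mult_left_mono card_balanced_cuts_Suc[OF V _ W]) auto
  also have "\<dots> = 16 ^ Suc k * (fact (Suc k))\<^sup>2 * real (card (balanced_cuts V d (Suc k)))"
    by (simp add: power_mult_distrib algebra_simps power2_eq_square)
  finally show ?case .
qed simp

lemma card_balanced_cuts_le:
  assumes V: "finite V"
  shows "card (balanced_cuts V d k) \<le> card (realizations V d) * (\<Sum>j\<le>2 * k. card V choose j)"
proof -
  let ?C = "\<lambda>E. {F. \<exists>A\<subseteq>V. F = cut_edges E A \<and> card F = 2 * k}"
  have fin: "finite (?C E)" if "E \<in> realizations V d" for E
    by (rule finite_subset[of _ "Pow E"]) (use finite_realization[OF V that] in \<open>auto simp: cut_edges_def\<close>)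
  have "balanced_cuts V d k \<subseteq> Sigma (realizations V d) ?C"
    by (auto simp: balanced_cuts_def balanced_def)
  then have "card (balanced_cuts V d k) \<le> card (Sigma (realizations V d) ?C)"
    by (rule card_mono[rotated]) (use fin finite_realizations[OF V] in blast)
  also have "\<dots> = (\<Sum>E\<in>realizations V d. card (?C E))"
    using fin finite_realizations[OF V] by (intro card_SigmaI) auto
  also have "\<dots> \<le> (\<Sum>E\<in>realizations V d. \<Sum>j\<le>2 * k. card V choose j)"
    by (intro sum_mono card_cuts_le[OF V]) (auto simp: realizations_def)
  finally show ?thesis by simp
qed

text \<open>A balanced closed set is a balanced cut without edges, so the iteration compares the
  realizations in question with \<open>balanced_cuts V d t\<close>. Since
  \<open>(fact t)^2 <= fact (2 * t)\<close>, the factorials cancel against the number of cuts, and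
  the ratio is at most \<open>(2 * t + 1) * (8192 * n^2 / w^2) ^ t\<close>. From
  \<open>w >= 200 * n\<close> the base is at most \<open>8192 / 40000 < 1 / 4\<close>.\<close>

lemma card_balanced_split_le:
  assumes V: "finite V" and W: "200 * card V \<le> sum d V" "441 * t\<^sup>2 \<le> sum d V"
    and n: "2 * t \<le> card V" "card V > 0"
  shows "real (card {E \<in> realizations V d. \<exists>A. balanced V d A \<and> closed_in E A})
    \<le> (2 * real t + 1) / 4 ^ t * real (card (realizations V d))"
proof -
  let ?Bad = "{E \<in> realizations V d. \<exists>A. balanced V d A \<and> closed_in E A}"
  let ?R = "real (card (realizations V d))"
  define w where "w = real (sum d V)"
  define n where "n = real (card V)"
  have quarter: "(x * (1 / 4)) ^ t = x ^ t / 4 ^ t" for x :: real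
    by (simp add: power_divide)
  have w: "w > 0" "200 * n \<le> w" using W(1) n(2) unfolding w_def n_def by (simp_all flip: of_nat_sum)
  \<comment> \<open>However many balanced closed sets a realization has, their common cut is
    \<open>{}\<close>, so it is counted once.\<close>
  have "card ?Bad = card ((\<lambda>E. (E, {} :: 'a set set)) ` ?Bad)"
    by (rule card_image[symmetric]) (auto simp: inj_on_def)
  also have "\<dots> \<le> card (balanced_cuts V d 0)"
    by (rule card_mono[OF finite_balanced_cuts[OF V]])
       (auto simp: balanced_cuts_def cut_edges_empty_iff[symmetric])
  finally have bad: "real (card ?Bad) \<le> real (card (balanced_cuts V d 0))" by simp
  have "(fact t)\<^sup>2 * (\<Sum>j\<le>2 * t. card V choose j) \<le> fact (2 * t) * (\<Sum>j\<le>2 * t. card V choose j)"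
    using fact_fact_dvd_fact[of t t, where 'a=nat]
    by (intro mult_right_mono) (auto simp: power2_eq_square mult_2 dest!: dvd_imp_le)
  also have "\<dots> \<le> (2 * t + 1) * card V ^ (2 * t)" by (rule sum_binomial_le) fact
  finally have "real ((fact t)\<^sup>2 * (\<Sum>j\<le>2 * t. card V choose j)) \<le> real ((2 * t + 1) * card V ^ (2 * t))"
    by (rule of_nat_mono)
  also have "\<dots> = (2 * real t + 1) * (n\<^sup>2) ^ t"
    unfolding of_nat_mult of_nat_power power_mult n_def by simp
  finally have binom: "(fact t)\<^sup>2 * real (\<Sum>j\<le>2 * t. card V choose j) \<le> (2 * real t + 1) * (n\<^sup>2) ^ t"
    by simp
  have "n\<^sup>2 * 16 \<le> w\<^sup>2 / 512 * (1 / 4)"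
  proof -
    have "(200 * n)\<^sup>2 \<le> w\<^sup>2" using w unfolding n_def by (intro power_mono) auto
    then have "40000 * n\<^sup>2 \<le> w\<^sup>2" by (simp add: power_mult_distrib)
    moreover have "0 \<le> n\<^sup>2" by simp
    ultimately show ?thesis by linarith
  qed
  then have n2: "(n\<^sup>2 * 16) ^ t \<le> (w\<^sup>2 / 512 * (1 / 4)) ^ t" by (intro power_mono) auto
  have "real (card ?Bad) * (w\<^sup>2 / 512) ^ t \<le> real (card (balanced_cuts V d 0)) * (w\<^sup>2 / 512) ^ t"
    using bad by (intro mult_right_mono) auto
  also have "\<dots> \<le> 16 ^ t * (fact t)\<^sup>2 * real (card (balanced_cuts V d t))"
    using card_balanced_cuts_iterate[OF V W order_refl] by (simp add: w_def)
  also have "\<dots> \<le> 16 ^ t * (fact t)\<^sup>2 * real (card (realizations V d) * (\<Sum>j\<le>2 * t. card V choose j))"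
    by (intro mult_left_mono of_nat_mono card_balanced_cuts_le[OF V]) auto
  also have "\<dots> = 16 ^ t * ?R * ((fact t)\<^sup>2 * real (\<Sum>j\<le>2 * t. card V choose j))" by simp
  also have "\<dots> \<le> 16 ^ t * ?R * ((2 * real t + 1) * (n\<^sup>2) ^ t)"
    by (intro mult_left_mono binom) auto
  also have "\<dots> = ?R * (2 * real t + 1) * (n\<^sup>2 * 16) ^ t" by (simp add: power_mult_distrib)
  also have "\<dots> \<le> ?R * (2 * real t + 1) * (w\<^sup>2 / 512 * (1 / 4)) ^ t"
    by (intro mult_left_mono n2) auto
  also have "\<dots> = ((2 * real t + 1) / 4 ^ t * ?R) * (w\<^sup>2 / 512) ^ t"
    unfolding quarter by simp
  finally show ?thesis using w(1) by (subst (asm) mult_le_cancel_right) (auto simp: zero_less_power)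
qed

section \<open>Sparse case: moving vertices of degree two\<close>

definition nbhd :: "'a set set \<Rightarrow> 'a \<Rightarrow> 'a set" where
  "nbhd E v = {y. {v, y} \<in> E}"

definition branch_weight :: "('a \<Rightarrow> nat) \<Rightarrow> 'a set \<Rightarrow> nat" where
  "branch_weight d S = sum d {v \<in> S. d v \<noteq> 2}"

text \<open>Recording the component along with the graph makes a move change \<open>c\<close> by
  exactly one.\<close>

definition light_components ::
    "'a set \<Rightarrow> ('a \<Rightarrow> nat) \<Rightarrow> real \<Rightarrow> nat \<Rightarrow> ('a set set \<times> 'a set) set" where
  "light_components V d \<mu> c = {(E, S). E \<in> realizations V d \<and> S \<subseteq> V \<and> component_set E S \<and>
     real (branch_weight d S) < \<mu> \<and> card {v \<in> S. d v = 2} = c}"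

text \<open>Intended for \<open>v\<close> of degree 2: then \<open>nbhd E v\<close> is a pair and
  serves itself as the edge that closes the gap, while \<open>v\<close> subdivides \<open>f\<close>.
  The reverse move has the same form, with \<open>nbhd E v\<close> in place of
  \<open>f\<close>.\<close>

definition move :: "'a set set \<Rightarrow> 'a \<Rightarrow> 'a set \<Rightarrow> 'a set set" where
  "move E v f = E - insert f {e \<in> E. v \<in> e} \<union> insert (nbhd E v) ((\<lambda>z. {v, z}) ` f)"

section \<open>The effect of a single move\<close>

lemma sum_branch_weight:
  assumes "finite S"
  shows "sum d S = branch_weight d S + 2 * card {v \<in> S. d v = 2}"
proof -
  have "sum d S = sum d {v \<in> S. d v \<noteq> 2} + sum d {v \<in> S. d v = 2}"
    using assms by (subst sum.union_disjoint[symmetric]) (auto intro: sum.cong)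
  then show ?thesis by (simp add: branch_weight_def)
qed

lemma nbhd_degree_2:
  assumes "E \<in> realizations V d" "v \<in> V" "d v = 2"
  obtains a b where "a \<noteq> b" "nbhd E v = {a, b}" "{e \<in> E. v \<in> e} = {{v, a}, {v, b}}"
    "{v, a} \<in> E" "{v, b} \<in> E" "v \<noteq> a" "v \<noteq> b"
proof -
  have sub: "E \<subseteq> pairs V" using assms(1) by (simp add: realizations_def)
  have "card (nbhd E v) = 2"
    using card_neighbours[OF sub, of v] assms unfolding nbhd_def by (simp add: realizations_def)
  then obtain a b where ab: "nbhd E v = {a, b}" "a \<noteq> b" by (auto simp: card_2_iff)
  then have e: "{v, a} \<in> E" "{v, b} \<in> E" unfolding nbhd_def by auto
  show ?thesis
  proof (rule that[OF ab(2,1) _ e])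
    show "{e \<in> E. v \<in> e} = {{v, a}, {v, b}}"
      using neighbours_as_edges[OF sub, of v] ab(1) unfolding nbhd_def by simp
    show "v \<noteq> a" "v \<noteq> b" using distinct_ends[OF sub] e by auto
  qed
qed

lemma move_realization:
  assumes E: "E \<in> realizations V d" and V: "finite V"
    and e: "{v, a} \<in> E" "{v, b} \<in> E" "{p, q} \<in> E" "{a, b} \<notin> E" "{v, p} \<notin> E" "{v, q} \<notin> E"
    and ne: "a \<noteq> b" "v \<noteq> p" "v \<noteq> q"
  shows "E - {{v, a}, {v, b}, {p, q}} \<union> {{a, b}, {v, p}, {v, q}} \<in> realizations V d"
proof -
  have sub: "E \<subseteq> pairs V" using E by (simp add: realizations_def)
  have V': "v \<in> V" "a \<in> V" "b \<in> V" "p \<in> V" "q \<in> V" and ne': "v \<noteq> a" "v \<noteq> b" "p \<noteq> q"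
    using sub e(1,2,3) by (auto simp: pairs_def)
  have "deg (E - {{v, a}, {v, b}, {p, q}} \<union> {{a, b}, {v, p}, {v, q}}) w = deg E w" for w
  proof (rule deg_exchange)
    have three: "(\<Sum>e\<in>{x, y, z}. g e) = g x + g y + g z"
      if "x \<noteq> y" "x \<noteq> z" "y \<noteq> z" for x y z and g :: "'a set \<Rightarrow> nat"
      using that by simp
    have "{v, a} \<noteq> {v, b}" "{v, a} \<noteq> {p, q}" "{v, b} \<noteq> {p, q}"
      "{a, b} \<noteq> {v, p}" "{a, b} \<noteq> {v, q}" "{v, p} \<noteq> {v, q}"
      using ne ne' by (auto simp: doubleton_eq_iff)
    then show "(\<Sum>e\<in>{{v, a}, {v, b}, {p, q}}. of_bool (w \<in> e))
        = (\<Sum>e\<in>{{a, b}, {v, p}, {v, q}}. of_bool (w \<in> e) :: nat)"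
      unfolding three[OF \<open>{v, a} \<noteq> {v, b}\<close> \<open>{v, a} \<noteq> {p, q}\<close> \<open>{v, b} \<noteq> {p, q}\<close>]
        three[OF \<open>{a, b} \<noteq> {v, p}\<close> \<open>{a, b} \<noteq> {v, q}\<close> \<open>{v, p} \<noteq> {v, q}\<close>]
      using ne ne' by auto
  qed (use e V sub finite_pairs finite_subset in auto)
  moreover have "{a, b} \<in> pairs V" "{v, p} \<in> pairs V" "{v, q} \<in> pairs V"
    using V' ne ne' by (auto simp: pairs_def)
  ultimately show ?thesis using E by (auto simp: realizations_def)
qed

text \<open>Removing \<open>v\<close> keeps the rest connected: a subset of \<open>S - {v}\<close>
  that is closed afterwards contains both of \<open>a\<close> and \<open>b\<close> or neither, so
  with \<open>v\<close> added in the first case it is closed in \<open>E\<close>, and the minimality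
  of \<open>S\<close> applies.\<close>

lemma move_component_set:
  assumes S: "component_set E S" and v: "v \<in> S" "a \<in> S" "b \<in> S" "v \<noteq> a" "v \<noteq> b"
    and inc: "{e \<in> E. v \<in> e} = {{v, a}, {v, b}}" and pq: "p \<notin> S" "q \<notin> S"
  shows "component_set (E - {{v, a}, {v, b}, {p, q}} \<union> {{a, b}, {v, p}, {v, q}}) (S - {v})"
    (is "component_set ?E' _")
  unfolding component_set_def
proof (intro conjI allI impI)
  show "S - {v} \<noteq> {}" using v by blast
  have old: "v \<notin> e" if "e \<in> E - {{v, a}, {v, b}, {p, q}}" for e
    using that inc by blast
  have clS: "e \<subseteq> S \<or> e \<inter> S = {}" if "e \<in> E" for e
    using S that by (auto simp: component_set_def closed_in_def)
  have minS: "T = {} \<or> T = S" if "T \<subseteq> S" "closed_in E T" for T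
    using S that by (auto simp: component_set_def)
  show "closed_in ?E' (S - {v})"
    unfolding closed_in_def
  proof
    fix e assume "e \<in> ?E'"
    then consider "e \<in> E - {{v, a}, {v, b}, {p, q}}" | "e = {a, b}" | "e = {v, p}" | "e = {v, q}" by blast
    then show "e \<subseteq> S - {v} \<or> e \<inter> (S - {v}) = {}"
    proof cases
      case 1
      then show ?thesis using old[OF 1] clS[of e] by blast
    qed (use v pq in auto)
  qed
  fix T assume T: "T \<subseteq> S - {v}" "closed_in ?E' T"
  have clT: "e \<subseteq> T \<or> e \<inter> T = {}" if "e \<in> ?E'" for e
    using bspec[OF T(2)[unfolded closed_in_def] that] .
  have edge_cases: "e = {v, a} \<or> e = {v, b} \<or> e = {p, q} \<or> v \<notin> e \<and> (e \<subseteq> T \<or> e \<inter> T = {})"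
    if "e \<in> E" for e
  proof (cases "e \<in> {{v, a}, {v, b}, {p, q}}")
    case False
    then have "e \<in> E - {{v, a}, {v, b}, {p, q}}" using that by simp
    then show ?thesis using clT[of e] old[of e] by simp
  qed auto
  show "T = {} \<or> T = S - {v}"
  proof (cases "a \<in> T")
    case True
    then have "b \<in> T" using clT[of "{a, b}"] by auto
    have "closed_in E (insert v T)"
      unfolding closed_in_def
    proof
      fix e assume "e \<in> E"
      then show "e \<subseteq> insert v T \<or> e \<inter> insert v T = {}"
        using edge_cases[of e] True \<open>b \<in> T\<close> pq T(1) v(1) by auto
    qed
    then have "insert v T = S" using minS[of "insert v T"] T(1) v(1) by blast
    then show ?thesis using T(1) by blast
  next
    case False
    then have "b \<notin> T" using clT[of "{a, b}"] by auto
    have "closed_in E T"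
      unfolding closed_in_def
    proof
      fix e assume "e \<in> E"
      then show "e \<subseteq> T \<or> e \<inter> T = {}"
        using edge_cases[of e] False \<open>b \<notin> T\<close> pq T(1) v(1) by auto
    qed
    then show ?thesis using minS[of T] T(1) v(1) by blast
  qed
qed

text \<open>Supplies the injection for the double counting. The new graph together with
  \<open>v\<close> and the edge \<open>nbhd E v\<close>, which lies inside the remaining component,
  determines both \<open>f\<close> and \<open>E\<close>. The condition
  \<open>nbhd E v \<notin> E\<close> keeps the graph simple.\<close>

lemma light_component_move:
  assumes V: "finite V" and ES: "(E, S) \<in> light_components V d \<mu> c"
    and v: "v \<in> S" "d v = 2" "nbhd E v \<notin> E" and f: "f \<in> E" "f \<inter> S = {}"
  shows "(move E v f, S - {v}) \<in> light_components V d \<mu> (c - 1)"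
    and "nbhd E v \<in> move E v f" "nbhd E v \<subseteq> S - {v}"
    and "nbhd (move E v f) v = f" "move (move E v f) v (nbhd E v) = E"
proof -
  have E: "E \<in> realizations V d" and S: "component_set E S" "S \<subseteq> V"
    and m: "real (branch_weight d S) < \<mu>" and c: "card {v \<in> S. d v = 2} = c"
    using ES by (auto simp: light_components_def)
  have sub: "E \<subseteq> pairs V" using E by (simp add: realizations_def)
  have vV: "v \<in> V" using v(1) S(2) by blast
  obtain a b where ab: "a \<noteq> b" "nbhd E v = {a, b}" "{e \<in> E. v \<in> e} = {{v, a}, {v, b}}"
    "{v, a} \<in> E" "{v, b} \<in> E" "v \<noteq> a" "v \<noteq> b"
    by (rule nbhd_degree_2[OF E vV v(2)])
  obtain p q where pq: "f = {p, q}" "p \<noteq> q" "p \<in> V" "q \<in> V" by (rule edgeE[OF sub f(1)])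
  have "e \<subseteq> S \<or> e \<inter> S = {}" if "e \<in> E" for e
    using S(1) that by (auto simp: component_set_def closed_in_def)
  from this[OF ab(4)] this[OF ab(5)] have abS: "a \<in> S" "b \<in> S" using v(1) by auto
  have pqS: "p \<notin> S" "q \<notin> S" using f(2) pq by auto
  have vpq: "v \<noteq> p" "v \<noteq> q" using pqS v by auto
  have "p \<noteq> a" "p \<noteq> b" "q \<noteq> a" "q \<noteq> b" using pqS abS by auto
  \<comment> \<open>Both neighbours of \<open>v\<close> lie in \<open>S\<close>, whereas the ends of
    \<open>f\<close> lie outside.\<close>
  have nvp: "{v, p} \<notin> E" "{v, q} \<notin> E"
    using ab(2) \<open>p \<noteq> a\<close> \<open>p \<noteq> b\<close> \<open>q \<noteq> a\<close> \<open>q \<noteq> b\<close> unfolding nbhd_def by blast+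
  have nab: "{a, b} \<notin> E" using v(3) ab(2) by simp
  have mv: "move E v f = E - {{v, a}, {v, b}, {p, q}} \<union> {{a, b}, {v, p}, {v, q}}"
    unfolding move_def ab pq(1) by auto
  have E': "move E v f \<in> realizations V d"
    unfolding mv by (rule move_realization[OF E V]) (use ab pq f nvp nab vpq in auto)
  have "component_set (move E v f) (S - {v})"
    unfolding mv by (rule move_component_set[OF S(1)]) (use ab v abS pqS in auto)
  moreover have "{u \<in> S - {v}. d u \<noteq> 2} = {u \<in> S. d u \<noteq> 2}" using v by auto
  moreover have "card {u \<in> S - {v}. d u = 2} = c - 1"
  proof -
    have "{u \<in> S - {v}. d u = 2} = {u \<in> S. d u = 2} - {v}" by auto
    then show ?thesis using c v finite_subset[OF S(2) V] by (simp add: card_Diff_singleton)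
  qed
  ultimately show "(move E v f, S - {v}) \<in> light_components V d \<mu> (c - 1)"
    using E' m S(2) by (auto simp: light_components_def branch_weight_def)
  show "nbhd E v \<in> move E v f" by (simp add: move_def)
  show "nbhd E v \<subseteq> S - {v}" using ab abS by auto
  have inc': "{e \<in> move E v f. v \<in> e} = {{v, p}, {v, q}}"
    unfolding mv using ab by blast
  have "{v, y} \<in> move E v f \<longleftrightarrow> y = p \<or> y = q" for y
  proof -
    have "{v, y} \<in> move E v f \<longleftrightarrow> {v, y} \<in> {e \<in> move E v f. v \<in> e}" by simp
    also have "\<dots> \<longleftrightarrow> y = p \<or> y = q" unfolding inc' using vpq by (auto simp: doubleton_eq_iff)
    finally show ?thesis .
  qed
  then show nb': "nbhd (move E v f) v = f" unfolding nbhd_def pq(1) by auto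
  have "move (move E v f) v (nbhd E v)
      = move E v f - {{a, b}, {v, p}, {v, q}} \<union> {{p, q}, {v, a}, {v, b}}"
    unfolding move_def[of "move E v f"] inc' nb' ab(2) unfolding pq(1) image_insert image_empty ..
  also have "\<dots> = E"
  proof -
    have "E - X \<union> Y - Y \<union> X = E" if "X \<subseteq> E" "Y \<inter> E = {}" for X Y :: "'a set set"
      using that by blast
    from this[of "{{v, a}, {v, b}, {p, q}}" "{{a, b}, {v, p}, {v, q}}"] show ?thesis
      unfolding mv using ab(4,5) f(1) pq(1) nab nvp by (simp add: insert_commute)
  qed
  finally show "move (move E v f) v (nbhd E v) = E" .
qed

section \<open>Double counting of moves out of and into a component\<close>

lemma finite_light_components:
  assumes "finite V"
  shows "finite (light_components V d \<mu> c)"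
  by (rule finite_subset[of _ "realizations V d \<times> Pow V"])
     (use assms finite_realizations[OF assms] in \<open>auto simp: light_components_def\<close>)

text \<open>A vertex of degree 2 can be taken out of its edge only if its neighbours are not adjacent.\<close>

lemma card_in_triangles:
  assumes V: "finite V" and E: "E \<in> realizations V d" and S: "component_set E S" "S \<subseteq> V"
    and c: "card {v \<in> S. d v = 2} \<ge> 4"
  shows "card {v \<in> S. d v = 2 \<and> nbhd E v \<in> E} \<le> branch_weight d S"
proof -
  have sub: "E \<subseteq> pairs V" using E by (simp add: realizations_def)
  have finS: "finite S" using S(2) V finite_subset by blast
  have cl: "e \<subseteq> S \<or> e \<inter> S = {}" if "e \<in> E" for e
    using S(1) that by (auto simp: component_set_def closed_in_def)
  let ?B = "{a \<in> S. d a \<noteq> 2}"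
  have "{v \<in> S. d v = 2 \<and> nbhd E v \<in> E} \<subseteq> (\<Union>a\<in>?B. nbhd E a)"
  proof
    fix v assume "v \<in> {v \<in> S. d v = 2 \<and> nbhd E v \<in> E}"
    then have v: "v \<in> S" "d v = 2" "nbhd E v \<in> E" by auto
    have vV: "v \<in> V" using v(1) S(2) by blast
    obtain a b where ab: "a \<noteq> b" "nbhd E v = {a, b}" "{e \<in> E. v \<in> e} = {{v, a}, {v, b}}"
      "{v, a} \<in> E" "{v, b} \<in> E" "v \<noteq> a" "v \<noteq> b"
      by (rule nbhd_degree_2[OF E vV v(2)])
    have abS: "a \<in> S" "b \<in> S" using cl[OF ab(4)] cl[OF ab(5)] v(1) by auto
    have "{a, b} \<in> E" using v(3) ab(2) by simp
    show "v \<in> (\<Union>a\<in>?B. nbhd E a)"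
    proof (rule ccontr)
      assume "v \<notin> (\<Union>a\<in>?B. nbhd E a)"
      moreover have "v \<in> nbhd E a" "v \<in> nbhd E b"
        using ab(4,5) by (auto simp: nbhd_def insert_commute)
      \<comment> \<open>Now all three vertices of the triangle have degree 2, so it is closed and
        equals \<open>S\<close>. But \<open>S\<close> has at least 4 vertices of degree 2.\<close>
      ultimately have d: "d a = 2" "d b = 2" using abS by auto
      have inc: "{e \<in> E. x \<in> e} = {{x, y}, {x, z}}"
        if x: "x \<in> S" "d x = 2" and yz: "y \<noteq> z" "{x, y} \<in> E" "{x, z} \<in> E" for x y z
      proof -
        have xV: "x \<in> V" using x S(2) by blast
        have fin: "finite {e \<in> E. x \<in> e}" using finite_realization[OF V E] by simp
        have "card {e \<in> E. x \<in> e} = 2"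
          using E x(2) xV by (simp add: realizations_def deg_def)
        moreover have "card {{x, y}, {x, z}} = 2" using yz(1) by (auto simp: doubleton_eq_iff)
        moreover have "{{x, y}, {x, z}} \<subseteq> {e \<in> E. x \<in> e}" using yz by auto
        ultimately show ?thesis using card_subset_eq[OF fin] by metis
      qed
      have ia: "{e \<in> E. a \<in> e} = {{a, v}, {a, b}}"
        using inc[of a v b] abS d ab \<open>{a, b} \<in> E\<close> by (simp add: insert_commute)
      have ib: "{e \<in> E. b \<in> e} = {{b, v}, {b, a}}"
        using inc[of b v a] abS d ab \<open>{a, b} \<in> E\<close> by (simp add: insert_commute)
      have ends: "e \<subseteq> {v, a, b}" if "e \<in> E" "e \<inter> {v, a, b} \<noteq> {}" for e
      proof -
        have "e \<in> {e \<in> E. v \<in> e} \<union> {e \<in> E. a \<in> e} \<union> {e \<in> E. b \<in> e}"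
          using that by auto
        then show ?thesis unfolding ab(3) ia ib by auto
      qed
      have "closed_in E {v, a, b}" unfolding closed_in_def using ends by blast
      moreover have "{v, a, b} \<subseteq> S" using v(1) abS by simp
      ultimately have "{v, a, b} = S" using S(1) unfolding component_set_def by blast
      then have "card {v \<in> S. d v = 2} \<le> card {v, a, b}"
        by (intro card_mono) auto
      also have "\<dots> \<le> 3" by (simp add: card_insert_le_m1)
      finally show False using c by simp
    qed
  qed
  then have "card {v \<in> S. d v = 2 \<and> nbhd E v \<in> E} \<le> card (\<Union>a\<in>?B. nbhd E a)"
  proof (rule card_mono[rotated])
    show "finite (\<Union>a\<in>?B. nbhd E a)"
      using finS finite_subset[OF neighbours_subset[OF sub] V] by (simp add: nbhd_def)
  qed
  also have "\<dots> \<le> (\<Sum>a\<in>?B. card (nbhd E a))" using finS by (intro card_UN_le) simp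
  also have "\<dots> = branch_weight d S"
    unfolding branch_weight_def nbhd_def card_neighbours[OF sub]
    using E S(2) by (intro sum.cong) (auto simp: realizations_def)
  finally show ?thesis .
qed

lemma card_edges_within:
  assumes V: "finite V" and E: "E \<in> realizations V d" and S: "closed_in E S" "S \<subseteq> V"
  shows "2 * card {e \<in> E. e \<subseteq> S} = branch_weight d S + 2 * card {v \<in> S. d v = 2}"
proof -
  have sub: "E \<subseteq> pairs V" using E by (simp add: realizations_def)
  have "sum d S = sum (deg E) S"
    using E S(2) by (intro sum.cong) (auto simp: realizations_def)
  also have "\<dots> = 2 * card {e \<in> E. e \<subseteq> S}"
    using sum_deg_cut[OF V sub S(2)] S(1) by (simp add: cut_edges_empty_iff[symmetric])
  finally show ?thesis
    using sum_branch_weight[of S d] S(2) V finite_subset by metis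
qed

text \<open>\<open>?O\<close> lists the moves out of a component: a vertex of degree 2 in no
  triangle, and an edge outside. \<open>?I\<close> contains the reverse moves: a vertex of degree 2
  outside, and an edge inside. Moves inject into reverse moves. Fewer than \<open>\<mu>\<close>
  vertices are lost to triangles, and the edges on either side are counted by degree sums; as these
  count each edge twice, both sides of the inequality are doubled.\<close>

lemma light_components_flow:
  assumes V: "finite V" and c: "c \<ge> 4" "\<mu> \<le> real c"
    and M: "\<mu> \<le> real (branch_weight d V)"
  defines "N \<equiv> real (card {v \<in> V. d v = 2})"
  shows "real (card (light_components V d \<mu> c)) *
      ((real c - \<mu>) * (real (branch_weight d V) - \<mu> + 2 * (N - real c)))
    \<le> real (card (light_components V d \<mu> (c - 1))) *
      ((N - real c + 1) * (\<mu> + 2 * (real c - 1)))"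
proof -
  let ?P = "light_components V d \<mu>"
  let ?O = "\<lambda>(E, S). {v \<in> S. d v = 2 \<and> nbhd E v \<notin> E} \<times> {f \<in> E. f \<inter> S = {}}"
  let ?I = "\<lambda>(E, S). {v \<in> V - S. d v = 2} \<times> {g \<in> E. g \<subseteq> S}"
  define g :: "('a set set \<times> 'a set) \<times> 'a \<times> 'a set \<Rightarrow> _" where
    "g = (\<lambda>((E, S), v, f). ((move E v f, S - {v}), v, nbhd E v))"
  define h :: "('a set set \<times> 'a set) \<times> 'a \<times> 'a set \<Rightarrow> _" where
    "h = (\<lambda>((E, S), v, f). ((move E v f, insert v S), v, nbhd E v))"
  have lc: "E \<in> realizations V d" "component_set E S" "closed_in E S" "S \<subseteq> V"
    "real (branch_weight d S) < \<mu>" "card {v \<in> S. d v = 2} = k" "finite S" "finite E"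
    if "(E, S) \<in> ?P k" for E S k
    using that finite_subset[OF _ V] finite_realization[OF V]
    by (auto simp: light_components_def component_set_def)
  have finO: "finite (?O p)" if "p \<in> ?P c" for p
    using lc[of "fst p" "snd p"] that by (auto split: prod.splits)
  have finI: "finite (?I p)" if "p \<in> ?P (c - 1)" for p
    using lc[of "fst p" "snd p"] that V by (auto split: prod.splits)
  have inj: "inj_on g (Sigma (?P c) ?O)"
  proof (rule inj_on_inverseI[of _ h])
    fix q assume "q \<in> Sigma (?P c) ?O"
    then obtain E S v f where q: "q = ((E, S), v, f)" and ES: "(E, S) \<in> ?P c"
      and v: "v \<in> S" "d v = 2" "nbhd E v \<notin> E" and f: "f \<in> E" "f \<inter> S = {}" by auto
    show "h (g q) = q"
      using light_component_move(4,5)[OF V ES v f] v(1) unfolding q g_def h_def by auto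
  qed
  have sub: "g ` Sigma (?P c) ?O \<subseteq> Sigma (?P (c - 1)) ?I"
  proof
    fix r assume "r \<in> g ` Sigma (?P c) ?O"
    then obtain E S v f where r: "r = g ((E, S), v, f)" and ES: "(E, S) \<in> ?P c"
      and v: "v \<in> S" "d v = 2" "nbhd E v \<notin> E" and f: "f \<in> E" "f \<inter> S = {}" by auto
    show "r \<in> Sigma (?P (c - 1)) ?I"
      using light_component_move(1-3)[OF V ES v f] v lc(4)[OF ES] unfolding r g_def by auto
  qed
  have finR: "finite (Sigma (?P (c - 1)) ?I)"
    by (intro finite_SigmaI finite_light_components V finI)
  have N_diff: "real (card {v \<in> V - S. d v = 2}) = N - real k" if "(E, S) \<in> ?P k" for E S k
  proof -
    have "{v \<in> V - S. d v = 2} = {v \<in> V. d v = 2} - {v \<in> S. d v = 2}" by auto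
    moreover have "{v \<in> S. d v = 2} \<subseteq> {v \<in> V. d v = 2}" using lc(4)[OF that] by auto
    moreover have "k \<le> card {v \<in> V. d v = 2}"
      using card_mono[OF _ calculation(2)] lc(6)[OF that] V by simp
    ultimately show ?thesis
      using lc(6,7)[OF that] V unfolding N_def
      by (simp add: card_Diff_subset of_nat_diff)
  qed
  have out: "(real c - \<mu>) * (real (branch_weight d V) - \<mu> + 2 * (N - real c)) \<le> 2 * real (card (?O (E, S)))"
    if ES: "(E, S) \<in> ?P c" for E S
  proof -
    note lc = lc[OF ES]
    have sub: "E \<subseteq> pairs V" using lc(1) by (simp add: realizations_def)
    have split: "{v \<in> S. d v = 2} = {v \<in> S. d v = 2 \<and> nbhd E v \<notin> E} \<union> {v \<in> S. d v = 2 \<and> nbhd E v \<in> E}"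
      by auto
    have "c \<le> card {v \<in> S. d v = 2 \<and> nbhd E v \<notin> E} + card {v \<in> S. d v = 2 \<and> nbhd E v \<in> E}"
      using card_Un_le[of "{v \<in> S. d v = 2 \<and> nbhd E v \<notin> E}" "{v \<in> S. d v = 2 \<and> nbhd E v \<in> E}"]
      unfolding split[symmetric] lc(6) .
    also have "card {v \<in> S. d v = 2 \<and> nbhd E v \<in> E} \<le> branch_weight d S"
      using card_in_triangles[OF V lc(1,2,4)] lc(6) c(1) by simp
    finally have v: "real c - \<mu> \<le> real (card {v \<in> S. d v = 2 \<and> nbhd E v \<notin> E})"
      using lc(5) by linarith
    have closed: "closed_in E (V - S)"
      using closed_in_Diff[OF closed_in_ground[OF sub] lc(3)] .
    have "{f \<in> E. f \<inter> S = {}} = {f \<in> E. f \<subseteq> V - S}" using sub by (auto simp: pairs_def)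
    moreover have "branch_weight d V = branch_weight d S + branch_weight d (V - S)"
    proof -
      have "{v \<in> V. d v \<noteq> 2} = {v \<in> S. d v \<noteq> 2} \<union> {v \<in> V - S. d v \<noteq> 2}" using lc(4) by auto
      then show ?thesis unfolding branch_weight_def
        using lc(7) V by (simp add: sum.union_disjoint disjoint_iff)
    qed
    ultimately have f: "real (branch_weight d V) - \<mu> + 2 * (N - real c) \<le> 2 * real (card {f \<in> E. f \<inter> S = {}})"
      using card_edges_within[OF V lc(1) closed] N_diff[OF ES] lc(5) by simp
    have "N - real c \<ge> 0" using N_diff[OF ES] by (metis of_nat_0_le_iff)
    then have "(real c - \<mu>) * (real (branch_weight d V) - \<mu> + 2 * (N - real c))
      \<le> real (card {v \<in> S. d v = 2 \<and> nbhd E v \<notin> E}) * (2 * real (card {f \<in> E. f \<inter> S = {}}))"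
      using v f c(2) M by (intro mult_mono) auto
    then show ?thesis by (simp add: card_cartesian_product)
  qed
  have inn: "2 * real (card (?I (E, S))) \<le> (N - real c + 1) * (\<mu> + 2 * (real c - 1))"
    if ES: "(E, S) \<in> ?P (c - 1)" for E S
  proof -
    note lc = lc[OF ES]
    have "2 * real (card {g \<in> E. g \<subseteq> S}) = real (branch_weight d S) + 2 * (real c - 1)"
      using card_edges_within[OF V lc(1,3,4)] lc(6) c(1) by (simp add: of_nat_diff flip: of_nat_mult)
    then have "2 * real (card {g \<in> E. g \<subseteq> S}) \<le> \<mu> + 2 * (real c - 1)" using lc(5) by simp
    \<comment> \<open>Here the component has only \<open>c - 1\<close> vertices of degree 2.\<close>
    moreover have "real (card {v \<in> V - S. d v = 2}) = N - real c + 1"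
      using N_diff[OF ES] c(1) by (simp add: of_nat_diff)
    ultimately have "real (card {v \<in> V - S. d v = 2}) * (2 * real (card {g \<in> E. g \<subseteq> S}))
        \<le> (N - real c + 1) * (\<mu> + 2 * (real c - 1))"
      by (intro mult_mono) (auto simp flip: \<open>_ = N - real c + 1\<close>)
    then show ?thesis by (simp add: card_cartesian_product)
  qed
  have "real (card (?P c)) * ((real c - \<mu>) * (real (branch_weight d V) - \<mu> + 2 * (N - real c)))
      = (\<Sum>p\<in>?P c. (real c - \<mu>) * (real (branch_weight d V) - \<mu> + 2 * (N - real c)))" by simp
  also have "\<dots> \<le> (\<Sum>p\<in>?P c. 2 * real (card (?O p)))"
    using out by (intro sum_mono) auto
  also have "\<dots> = 2 * real (card (Sigma (?P c) ?O))"
    using finO by (simp add: card_SigmaI finite_light_components[OF V] sum_distrib_left)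
  also have "\<dots> \<le> 2 * real (card (Sigma (?P (c - 1)) ?I))"
    using card_inj_on_le[OF inj sub finR] by simp
  also have "\<dots> = (\<Sum>p\<in>?P (c - 1). 2 * real (card (?I p)))"
    using finI by (simp add: card_SigmaI finite_light_components[OF V] sum_distrib_left)
  also have "\<dots> \<le> (\<Sum>p\<in>?P (c - 1). (N - real c + 1) * (\<mu> + 2 * (real c - 1)))"
    using inn by (intro sum_mono) auto
  finally show ?thesis by simp
qed

text \<open>\<open>N\<close> stands for the number of vertices of degree 2 outside the component,
  and \<open>h\<close> for the average branch weight per vertex. The branch weight outside
  contributes a gain of \<open>5 * h / 16\<close> over \<open>N + 1\<close>; a fraction
  \<open>\<alpha> = \<mu> / c\<close> is lost to triangles and to the branch weight inside, and a
  gain of \<open>h / 16\<close> survives.\<close>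

lemma flow_rate_ineq:
  fixes N n h \<mu> c :: real
  assumes "0 \<le> N" "N + 1 \<le> n" "0 < h" "h \<le> 200" "16 \<le> h * n" "0 < c"
    and \<mu>: "0 \<le> \<mu>" "\<mu> \<le> h * c / 625" "\<mu> \<le> h * n / 4"
  shows "(1 + h / 16) * ((N + 1) * (\<mu> + 2 * (c - 1))) \<le> (c - \<mu>) * (h * n - \<mu> + 2 * N)"
proof -
  define \<alpha> where "\<alpha> = \<mu> / c"
  have \<alpha>: "0 \<le> \<alpha>" "\<alpha> \<le> h / 625" "\<mu> = \<alpha> * c"
    using assms by (auto simp: \<alpha>_def field_simps)
  have "(N + 1) * (5 * h / 16) \<le> n * (5 * h / 16)"
    using assms by (intro mult_right_mono) auto
  moreover define X P where "X = (N + 1) * (5 * h / 16)" and "P = h * n"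
  moreover have "n * (5 * h / 16) = 5 / 16 * P" by (simp add: P_def)
  ultimately have "X \<le> 5 / 16 * P" by (simp add: mult.commute)
  moreover have "16 \<le> P" "\<mu> \<le> P / 4" using assms by (auto simp: P_def)
  ultimately have "N + 1 + X \<le> N + (P - \<mu>) / 2" by argo
  \<comment> \<open>The preceding inequality holds because
    \<open>(P - \<mu>) / 2 >= 3 / 8 * P >= 5 / 16 * P + 1\<close>.\<close>
  moreover have "(N + 1) * (1 + 5 * h / 16) = N + 1 + X"
    by (simp add: X_def algebra_simps)
  ultimately have 1: "(N + 1) * (1 + 5 * h / 16) \<le> N + (h * n - \<mu>) / 2"
    by (simp add: P_def)
  \<comment> \<open>The bound on \<open>h\<close> makes the quadratic terms in the next two
    expansions at most \<open>h / 100\<close> and \<open>h / 10\<close>.\<close>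
  have "h * h \<le> h * 200" using assms by (intro mult_left_mono) auto
  moreover have "(1 + h / 16) * (1 + h / 1250) = 1 + h / 16 + h / 1250 + h * h / 20000"
    by (simp add: field_simps)
  moreover have "(1 - h / 625) * (1 + 5 * h / 16) = 1 + 5 * h / 16 - h / 625 - h * h / 2000"
    by (simp add: field_simps)
  ultimately have "(1 + h / 16) * (1 + h / 1250) \<le> (1 - h / 625) * (1 + 5 * h / 16)"
    using assms(3) by argo
  moreover have "(1 + h / 16) * (1 + \<alpha> / 2) \<le> (1 + h / 16) * (1 + h / 1250)"
    using assms \<alpha> by (intro mult_left_mono) auto
  moreover have "(1 - h / 625) * (1 + 5 * h / 16) \<le> (1 - \<alpha>) * (1 + 5 * h / 16)"
    using assms \<alpha> by (intro mult_right_mono) auto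
  ultimately have 2: "(1 + h / 16) * (1 + \<alpha> / 2) \<le> (1 - \<alpha>) * (1 + 5 * h / 16)"
    by linarith
  have "(1 + h / 16) * ((N + 1) * (\<mu> + 2 * (c - 1))) \<le> (1 + h / 16) * ((N + 1) * (\<mu> + 2 * c))"
    using assms by (intro mult_left_mono) auto
  also have "\<dots> = 2 * c * (N + 1) * ((1 + h / 16) * (1 + \<alpha> / 2))"
    by (simp add: \<alpha>(3) algebra_simps)
  also have "\<dots> \<le> 2 * c * (N + 1) * ((1 - \<alpha>) * (1 + 5 * h / 16))"
    using 2 assms by (intro mult_left_mono) auto
  also have "\<dots> = 2 * c * (1 - \<alpha>) * ((N + 1) * (1 + 5 * h / 16))" by simp
  also have "\<dots> \<le> 2 * c * (1 - \<alpha>) * (N + (h * n - \<mu>) / 2)"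
    using 1 assms \<alpha> by (intro mult_left_mono) auto
  also have "\<dots> = (c - \<mu>) * (h * n - \<mu> + 2 * N)" by (simp add: \<alpha>(3) field_simps)
  finally show ?thesis .
qed

text \<open>Combines the double counting with \<open>flow_rate_ineq\<close> and cancels the number
  of reverse moves. The threshold \<open>\<theta>\<close> keeps \<open>\<mu>\<close> a small
  fraction of every \<open>c\<close> considered.\<close>

lemma light_components_decay:
  assumes V: "finite V" and n: "real (card V) = n" and M: "real (branch_weight d V) = h * n"
    and h: "0 < h" "h \<le> 200" "16 \<le> h * n"
    and \<mu>: "0 \<le> \<mu>" "\<mu> \<le> h * \<theta> / 625" "\<mu> \<le> h * n / 4"
    and \<theta>: "4 \<le> \<theta>"
  shows "\<theta> \<le> real c \<Longrightarrow>
    real (card (light_components V d \<mu> c)) * (1 + h / 16) \<le> real (card (light_components V d \<mu> (c - 1)))"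
proof -
  assume c: "\<theta> \<le> real c"
  let ?P = "light_components V d \<mu>" and ?N = "real (card {v \<in> V. d v = 2})"
  show ?thesis
  \<comment> \<open>A member gives \<open>c <= ?N\<close>, so that the factors to be multiplied are
    nonnegative.\<close>
  proof (cases "?P c = {}")
    case False
    then obtain E S where "S \<subseteq> V" "card {v \<in> S. d v = 2} = c"
      by (auto simp: light_components_def)
    then have "c \<le> card {v \<in> V. d v = 2}" using V by (auto intro: card_mono)
    then have N0: "0 \<le> ?N - real c" by simp
    have "card {v \<in> V. d v = 2} \<le> card V" using V by (auto intro: card_mono)
    then have Nn: "?N - real c + 1 \<le> n" using c \<theta> n by linarith
    have "h * \<theta> \<le> h * real c" using h c by (intro mult_left_mono) auto
    then have \<mu>c: "\<mu> \<le> h * real c / 625" using \<mu>(2) by linarith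
    have "h * real c \<le> 200 * real c" using h c \<theta> by (intro mult_right_mono) auto
    then have "\<mu> \<le> real c" using \<mu>c c \<theta> by linarith
    let ?L = "(?N - real c + 1) * (\<mu> + 2 * (real c - 1))"
    have "real (card (?P c)) * ((1 + h / 16) * ?L)
        \<le> real (card (?P c)) * ((real c - \<mu>) * (h * n - \<mu> + 2 * (?N - real c)))"
      using N0 Nn h \<mu> \<mu>c c \<theta> by (intro mult_left_mono flow_rate_ineq) auto
    also have "\<dots> \<le> real (card (?P (c - 1))) * ?L"
      using light_components_flow[OF V _ \<open>\<mu> \<le> real c\<close>, of d] c \<theta> \<mu> h unfolding M by simp
    finally have "(real (card (?P c)) * (1 + h / 16)) * ?L \<le> real (card (?P (c - 1))) * ?L"
      by (simp add: mult.assoc)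
    moreover have "0 < ?L" using N0 \<mu>(1) c \<theta> by (intro mult_pos_pos) auto
    ultimately show ?thesis by (subst (asm) mult_le_cancel_right_pos)
  qed simp
qed

section \<open>From the decay to a bound on the bad realizations\<close>

lemma light_components_decay_iterate:
  assumes "finite V" "real (card V) = n" "real (branch_weight d V) = h * n"
    and h: "0 < h" "h \<le> 200" "16 \<le> h * n"
    and "0 \<le> \<mu>" "\<mu> \<le> h * \<theta> / 625" "\<mu> \<le> h * n / 4" and \<theta>: "4 \<le> \<theta>"
  shows "\<theta> + real k \<le> real c \<Longrightarrow>
    real (card (light_components V d \<mu> c)) * (1 + h / 16) ^ k \<le> real (card (light_components V d \<mu> (c - k)))"
proof (induction k)
  case (Suc k)
  have "real (card (light_components V d \<mu> c)) * (1 + h / 16) ^ Suc k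
      = (real (card (light_components V d \<mu> c)) * (1 + h / 16) ^ k) * (1 + h / 16)" by simp
  also have "\<dots> \<le> real (card (light_components V d \<mu> (c - k))) * (1 + h / 16)"
    using Suc h by (intro mult_right_mono) auto
  also have "\<dots> \<le> real (card (light_components V d \<mu> (c - k - 1)))"
    using Suc.prems \<theta> by (intro light_components_decay[OF assms]) linarith
  finally show ?case by simp
qed simp

lemma card_large_components:
  assumes V: "finite V" and \<theta>: "0 < \<theta>"
  shows "real (card {S. S \<subseteq> V \<and> component_set E S \<and> \<theta> \<le> real (card S)}) * \<theta> \<le> real (card V)"
proof -
  let ?C = "{S. S \<subseteq> V \<and> component_set E S \<and> \<theta> \<le> real (card S)}"
  have finC: "finite ?C" by (rule finite_subset[of _ "Pow V"]) (use V in auto)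
  have "real (card ?C) * \<theta> = (\<Sum>S\<in>?C. \<theta>)" by simp
  also have "\<dots> \<le> (\<Sum>S\<in>?C. real (card S))" by (intro sum_mono) auto
  also have "\<dots> = real (card (\<Union>?C))"
  proof -
    have "card (\<Union>?C) = sum card ?C"
    proof (rule card_Union_disjoint)
      show "pairwise disjnt ?C"
        using component_sets_disjoint by (auto simp: pairwise_def disjnt_def)
      show "finite A" if "A \<in> ?C" for A using that V finite_subset by blast
    qed
    then show ?thesis by simp
  qed
  also have "\<dots> \<le> real (card V)" using V by (intro of_nat_mono card_mono) auto
  finally show ?thesis .
qed

text \<open>Shifting every \<open>c >= 2 * \<theta>\<close> down by \<open>k\<close>, the integer
  part of \<open>\<theta>\<close>, gains the factor \<open>(1 + h / 16) ^ k\<close> and stays above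
  \<open>\<theta>\<close>. The pairs reached are a realization with a component of order at least
  \<open>\<theta>\<close>; components are disjoint, so each realization has at most
  \<open>n / \<theta>\<close> of them.\<close>

lemma card_large_light_component_le:
  assumes V: "finite V" "card V > 0" and n: "real (card V) = n" and M: "real (branch_weight d V) = h * n"
    and h: "0 < h" "h \<le> 200" "16 \<le> h * n"
    and \<mu>: "0 \<le> \<mu>" "\<mu> \<le> h * \<theta> / 625" "\<mu> \<le> h * n / 4" and \<theta>: "4 \<le> \<theta>"
  shows "real (card {E \<in> realizations V d. \<exists>S\<subseteq>V. component_set E S \<and>
      real (branch_weight d S) < \<mu> \<and> 2 * \<theta> \<le> real (card {v \<in> S. d v = 2})}) * (\<theta> * (\<theta> * h / 32))
    \<le> n * real (card (realizations V d))"
proof -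
  let ?P = "light_components V d \<mu>"
  let ?Bad = "{E \<in> realizations V d. \<exists>S\<subseteq>V. component_set E S \<and>
      real (branch_weight d S) < \<mu> \<and> 2 * \<theta> \<le> real (card {v \<in> S. d v = 2})}"
  let ?C = "{c. c \<le> card V \<and> 2 * \<theta> \<le> real c}" and ?C' = "{c. c \<le> card V \<and> \<theta> \<le> real c}"
  let ?L = "Sigma (realizations V d) (\<lambda>E. {S. S \<subseteq> V \<and> component_set E S \<and> \<theta> \<le> real (card S)})"
  define k where "k = nat \<lfloor>\<theta>\<rfloor>"
  have k: "real k \<le> \<theta>" "\<theta> / 2 \<le> real k" using \<theta> unfolding k_def by linarith+
  have finL: "finite ?L"
    using finite_realizations[OF V(1)] V(1) by (intro finite_SigmaI) auto
  have "?Bad \<subseteq> fst ` (\<Union>c\<in>?C. ?P c)"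
  proof
    fix E assume "E \<in> ?Bad"
    then obtain S where S: "E \<in> realizations V d" "S \<subseteq> V" "component_set E S"
      "real (branch_weight d S) < \<mu>" "2 * \<theta> \<le> real (card {v \<in> S. d v = 2})" by blast
    then have "card {v \<in> S. d v = 2} \<in> ?C" using V(1) by (auto intro: card_mono)
    moreover have "(E, S) \<in> ?P (card {v \<in> S. d v = 2})"
      using S by (simp add: light_components_def)
    ultimately show "E \<in> fst ` (\<Union>c\<in>?C. ?P c)" by force
  qed
  then have "card ?Bad \<le> card (\<Union>c\<in>?C. ?P c)"
    by (rule surj_card_le[rotated]) (use finite_light_components[OF V(1)] in auto)
  also have "\<dots> \<le> (\<Sum>c\<in>?C. card (?P c))" by (rule card_UN_le) simp
  finally have "real (card ?Bad) * (1 + h / 16) ^ k \<le> (\<Sum>c\<in>?C. real (card (?P c))) * (1 + h / 16) ^ k"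
    using h by (intro mult_right_mono) (simp_all flip: of_nat_sum)
  also have "\<dots> = (\<Sum>c\<in>?C. real (card (?P c)) * (1 + h / 16) ^ k)" by (rule sum_distrib_right)
  also have "\<dots> \<le> (\<Sum>c\<in>?C. real (card (?P (c - k))))"
    using k(1) by (intro sum_mono light_components_decay_iterate[OF V(1) n M h \<mu> \<theta>]) auto
  also have "\<dots> = (\<Sum>c\<in>(\<lambda>c. c - k) ` ?C. real (card (?P c)))"
  proof -
    have "inj_on (\<lambda>c. c - k) ?C"
    proof (rule inj_onI)
      fix x y assume "x \<in> ?C" "y \<in> ?C" "x - k = y - k"
      moreover have "k \<le> x" "k \<le> y" using calculation(1,2) k(1) \<theta> by auto
      ultimately show "x = y" by simp
    qed
    then show ?thesis by (simp add: sum.reindex)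
  qed
  also have "\<dots> \<le> (\<Sum>c\<in>?C'. real (card (?P c)))"
    using k(1) by (intro sum_mono2) (auto simp: of_nat_diff)
  also have "\<dots> = real (card (\<Union>c\<in>?C'. ?P c))"
  proof -
    have "card (\<Union>c\<in>?C'. ?P c) = (\<Sum>c\<in>?C'. card (?P c))"
      using finite_light_components[OF V(1)]
      by (intro card_UN_disjoint) (auto simp: light_components_def)
    then show ?thesis by simp
  qed
  also have "\<dots> \<le> real (card ?L)"
  proof (intro of_nat_mono card_mono finL subsetI)
    fix p assume "p \<in> (\<Union>c\<in>?C'. ?P c)"
    then obtain E S where p: "p = (E, S)" and S: "E \<in> realizations V d" "S \<subseteq> V" "component_set E S"
      "\<theta> \<le> real (card {v \<in> S. d v = 2})"
      by (auto simp: light_components_def)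
    have "card {v \<in> S. d v = 2} \<le> card S"
      using finite_subset[OF S(2) V(1)] by (auto intro: card_mono)
    then show "p \<in> ?L" using p S by auto
  qed
  finally have "real (card ?Bad) * (1 + h / 16) ^ k \<le> real (card ?L)" .
  moreover have "\<theta> * h / 32 \<le> (1 + h / 16) ^ k"
  proof -
    have "\<theta> / 2 * (h / 16) \<le> real k * (h / 16)" using k(2) h by (intro mult_right_mono) auto
    moreover have "\<theta> * h / 32 = \<theta> / 2 * (h / 16)" by simp
    ultimately have "\<theta> * h / 32 \<le> 1 + real k * (h / 16)" by linarith
    \<comment> \<open>Only the linear part of the gain is kept. It suffices because
      \<open>n * h\<close>, the total branch weight, tends to infinity.\<close>
    also have "\<dots> \<le> (1 + h / 16) ^ k" using h by (intro Bernoulli_inequality) auto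
    finally show ?thesis .
  qed
  then have "real (card ?Bad) * (\<theta> * h / 32) \<le> real (card ?Bad) * (1 + h / 16) ^ k"
    by (intro mult_left_mono) auto
  ultimately have "real (card ?Bad) * (\<theta> * h / 32) * \<theta> \<le> real (card ?L) * \<theta>"
    using \<theta> by (intro mult_right_mono) auto
  also have "real (card ?L) = (\<Sum>E\<in>realizations V d. real (card {S. S \<subseteq> V \<and> component_set E S \<and> \<theta> \<le> real (card S)}))"
    using V(1) finite_realizations[OF V(1)] by (subst card_SigmaI) auto
  also have "\<dots> * \<theta> \<le> (\<Sum>E\<in>realizations V d. n)"
    unfolding sum_distrib_right
    using card_large_components[OF V(1), of \<theta>] \<theta> n by (intro sum_mono) auto
  finally show ?thesis by (simp add: algebra_simps)
qed

section \<open>From multigraphs to sets of edges\<close>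

text \<open>Forgets multiplicities and turns a loop into a singleton. A simple graph on given
  vertices is determined by it; for the multigraphs that arise under suppression it serves only to
  speak of closed sets.\<close>

definition edge_sets :: "'a multigraph \<Rightarrow> 'a set set" where
  "edge_sets G = set_mset ` set_mset (edges G)"

lemma simple_edge:
  assumes "simple G" "e \<in># edges G"
  obtains u v where "u \<noteq> v" "e = {#u, v#}" "u \<in> verts G" "v \<in> verts G"
proof -
  obtain u v where uv: "u \<noteq> v" "e = {#u, v#}" using assms by (auto simp: simple_def)
  moreover have "set_mset e \<subseteq> verts G" using assms by (auto simp: simple_def multigraph_def)
  ultimately show ?thesis using that by auto
qed

lemma simple_edges_mset_set:
  assumes "simple G"
  shows "edges G = mset_set (set_mset (edges G))"
proof (rule multiset_eqI)
  fix e show "count (edges G) e = count (mset_set (set_mset (edges G))) e"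
    using assms by (cases "e \<in># edges G") (auto simp: simple_def not_in_iff)
qed

lemma simple_edge_mset_set:
  assumes "simple G" "e \<in># edges G"
  shows "mset_set (set_mset e) = e"
proof -
  obtain u v where "u \<noteq> v" "e = {#u, v#}" using simple_edge[OF assms] by metis
  then show ?thesis by simp
qed

lemma inj_on_set_mset_edges: "simple G \<Longrightarrow> inj_on set_mset (set_mset (edges G))"
  by (rule inj_on_inverseI[of _ mset_set]) (rule simple_edge_mset_set)

lemma edge_sets_subset_pairs:
  assumes "simple G"
  shows "edge_sets G \<subseteq> pairs (verts G)"
proof
  fix x assume "x \<in> edge_sets G"
  then obtain e where e: "e \<in># edges G" "x = set_mset e" by (auto simp: edge_sets_def)
  obtain u v where "u \<noteq> v" "e = {#u, v#}" "u \<in> verts G" "v \<in> verts G"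
    by (rule simple_edge[OF assms e(1)])
  then show "x \<in> pairs (verts G)" using e(2) by (auto simp: pairs_def)
qed

lemma deg_edge_sets:
  assumes "simple G"
  shows "deg (edge_sets G) v = degree G v"
proof -
  have "count e v = of_bool (v \<in># e)" if e: "e \<in># edges G" for e
  proof -
    obtain x y where "x \<noteq> y" "e = {#x, y#}" using simple_edge[OF assms e] by metis
    then show ?thesis by auto
  qed
  then have "(\<Sum>e\<in>set_mset (edges G). count e v) = (\<Sum>e\<in>set_mset (edges G). of_bool (v \<in># e))"
    by (rule sum.cong[OF refl])
  moreover have "degree G v = (\<Sum>e\<in>set_mset (edges G). count e v)"
    unfolding degree_def by (subst simple_edges_mset_set[OF assms]) (simp only: sum_unfold_sum_mset)
  ultimately have "degree G v = (\<Sum>e\<in>set_mset (edges G). of_bool (v \<in># e))" by simp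
  also have "\<dots> = card {e \<in> set_mset (edges G). v \<in># e}"
    by (simp add: of_bool_def sum.If_cases Int_def)
  also have "\<dots> = card (set_mset ` {e \<in> set_mset (edges G). v \<in># e})"
    by (intro card_image[symmetric] inj_on_subset[OF inj_on_set_mset_edges[OF assms]]) auto
  also have "set_mset ` {e \<in> set_mset (edges G). v \<in># e} = {e \<in> edge_sets G. v \<in> e}"
    by (auto simp: edge_sets_def)
  finally show ?thesis by (simp add: deg_def)
qed

lemma inj_on_edge_sets: "inj_on edge_sets {G :: 'a multigraph. simple G \<and> verts G = V}"
proof (rule inj_on_inverseI[of _ "\<lambda>E. \<lparr>verts = V, edges = mset_set (mset_set ` E)\<rparr>"])
  fix G :: "'a multigraph" assume G: "G \<in> {G. simple G \<and> verts G = V}"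
  have "mset_set ` edge_sets G = set_mset (edges G)"
    using G simple_edge_mset_set[of G] by (force simp: edge_sets_def image_image)
  then show "\<lparr>verts = V, edges = mset_set (mset_set ` edge_sets G)\<rparr> = G"
    using G simple_edges_mset_set[of G] by simp
qed

lemma edge_sets_surj:
  assumes V: "finite V" and E: "E \<subseteq> pairs V"
  obtains G where "simple G" "verts G = V" "edge_sets G = E"
proof -
  let ?G = "\<lparr>verts = V, edges = mset_set (mset_set ` E)\<rparr>"
  have finE: "finite E" using finite_subset[OF E finite_pairs[OF V]] .
  have edge: "\<exists>u v. u \<noteq> v \<and> u \<in> V \<and> v \<in> V \<and> e = {u, v} \<and> mset_set e = {#u, v#}" if "e \<in> E" for e
  proof -
    obtain a b where "e = {a, b}" "a \<noteq> b" "a \<in> V" "b \<in> V" by (rule edgeE[OF E \<open>e \<in> E\<close>])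
    then show ?thesis by (intro exI[of _ a] exI[of _ b]) simp
  qed
  have set: "set_mset (mset_set e) = e" if "e \<in> E" for e using edge[OF that] by auto
  show ?thesis
  proof (rule that[of ?G])
    have "size e = 2 \<and> set_mset e \<subseteq> V \<and> count (edges ?G) e = 1 \<and> (\<exists>u v. u \<noteq> v \<and> e = {#u, v#})"
      if e: "e \<in># edges ?G" for e
    proof -
      obtain x where x: "x \<in> E" "e = mset_set x" using e finE by auto
      obtain u v where "u \<noteq> v" "u \<in> V" "v \<in> V" "e = {#u, v#}" using edge[OF x(1)] x(2) by metis
      moreover have "count (edges ?G) e = 1" using x finE by simp
      ultimately show ?thesis by auto
    qed
    then show "simple ?G" using V unfolding simple_def multigraph_def by auto
    have "set_mset ` set_mset (edges ?G) = (\<lambda>e. set_mset (mset_set e)) ` E"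
      using finE by (simp add: image_image)
    also have "\<dots> = E" using set by simp
    finally show "edge_sets ?G = E" by (simp add: edge_sets_def)
  qed simp
qed

text \<open>Turns probabilities under \<open>random_graph\<close> into proportions of
  \<open>realizations\<close>.\<close>

lemma bij_betw_edge_sets:
  "bij_betw edge_sets (graphs_with_degrees n d) (realizations {1..n} d)"
  unfolding bij_betw_def
proof
  show "inj_on edge_sets (graphs_with_degrees n d)"
    by (rule inj_on_subset[OF inj_on_edge_sets[of "{1..n}"]]) (auto simp: graphs_with_degrees_def)
  show "edge_sets ` graphs_with_degrees n d = realizations {1..n} d"
  proof
    show "edge_sets ` graphs_with_degrees n d \<subseteq> realizations {1..n} d"
      using edge_sets_subset_pairs deg_edge_sets
      by (fastforce simp: graphs_with_degrees_def realizations_def)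
    show "realizations {1..n} d \<subseteq> edge_sets ` graphs_with_degrees n d"
    proof
      fix E assume E: "E \<in> realizations {1..n} d"
      then obtain G where G: "simple G" "verts G = {1..n}" "edge_sets G = E"
        using edge_sets_surj[of "{1..n}" E] by (auto simp: realizations_def)
      then have "G \<in> graphs_with_degrees n d"
        using E deg_edge_sets[OF G(1)] by (auto simp: graphs_with_degrees_def realizations_def)
      then show "E \<in> edge_sets ` graphs_with_degrees n d" using G(3) by blast
    qed
  qed
qed

text \<open>A minimal closed set containing \<open>u\<close> is minimal among all nonempty closed
  sets: a closed part of it that avoids \<open>u\<close> could be removed.\<close>

lemma component_set_containing:
  assumes V: "finite V" "closed_in E V" and u: "u \<in> V"
  obtains U where "U \<subseteq> V" "u \<in> U" "component_set E U"
proof -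
  let ?F = "{A. A \<subseteq> V \<and> u \<in> A \<and> closed_in E A}"
  have "finite ?F" by (rule finite_subset[of _ "Pow V"]) (use V in auto)
  moreover have "V \<in> ?F" using V u by simp
  then have "?F \<noteq> {}" by (metis empty_iff)
  ultimately obtain U where U: "U \<in> ?F" "\<forall>A\<in>?F. A \<subseteq> U \<longrightarrow> U = A"
    by (elim finite_has_minimal[THEN bexE])
  have "T = {} \<or> T = U" if T: "T \<subseteq> U" "closed_in E T" for T
  proof (cases "u \<in> T")
    case True
    then have "T \<in> ?F" using U(1) T by simp (metis subset_trans)
    from mp[OF bspec[OF U(2) this] T(1)] show ?thesis by simp
  next
    case False
    have "closed_in E (U - T)" by (rule closed_in_Diff) (use U T in auto)
    then have "U - T \<in> ?F" using U(1) False by auto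
    from mp[OF bspec[OF U(2) this]] show ?thesis using T by blast
  qed
  then have "component_set E U" using U(1) unfolding component_set_def by blast
  then show ?thesis using U(1) that[of U] by blast
qed

text \<open>Links \<open>components\<close>, defined by paths, to minimal closed sets: paths cannot
  leave a closed set, and the reachable part of \<open>U\<close> is itself closed. The size is
  prescribed only for edges that meet \<open>U\<close>, as suppression may create edges of size one
  elsewhere.\<close>

lemma reachable_eq_component_set:
  assumes U: "component_set (edge_sets H) U" "U \<subseteq> verts H" "w \<in> U"
    and size: "\<And>e. e \<in># edges H \<Longrightarrow> set_mset e \<inter> U \<noteq> {} \<Longrightarrow> size e = 2"
  shows "{v \<in> verts H. (adjacent H)\<^sup>*\<^sup>* w v} = U"
proof
  have cl: "set_mset e \<subseteq> U \<or> set_mset e \<inter> U = {}" if "e \<in># edges H" for e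
    using U(1) that by (auto simp: component_set_def closed_in_def edge_sets_def)
  have "v \<in> U" if "(adjacent H)\<^sup>*\<^sup>* w v" for v
    using that
  proof (induction rule: rtranclp_induct)
    case (step x y)
    then show ?case using cl[of "{#x, y#}"] by (auto simp: adjacent_def)
  qed (rule U(3))
  then show "{v \<in> verts H. (adjacent H)\<^sup>*\<^sup>* w v} \<subseteq> U" by blast
  let ?R = "{v \<in> U. (adjacent H)\<^sup>*\<^sup>* w v}"
  have "set_mset e \<subseteq> ?R \<or> set_mset e \<inter> ?R = {}" if e: "e \<in># edges H" for e
  proof (cases "set_mset e \<inter> ?R = {}")
    case False
    then obtain x where x: "x \<in># e" "x \<in> U" "(adjacent H)\<^sup>*\<^sup>* w x" by auto
    have "size e = 2" using size[OF e] x by blast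
    then have "size (e - {#x#}) = 1" using x(1) by (simp add: size_Diff_singleton)
    then obtain y where "e - {#x#} = {#y#}" using size_1_singleton_mset by blast
    then have xy: "e = {#x, y#}" using x(1) by (metis insert_DiffM)
    then have "y \<in> U" using cl[OF e] x(2) by auto
    moreover have "(adjacent H)\<^sup>*\<^sup>* w y"
      using x(3) e xy by (auto simp: adjacent_def intro: rtranclp.rtrancl_into_rtrancl)
    ultimately show ?thesis using x xy by auto
  qed simp
  then have "closed_in (edge_sets H) ?R" by (auto simp: closed_in_def edge_sets_def)
  moreover have "w \<in> ?R" using U(3) by simp
  moreover have "?R \<subseteq> U" by blast
  ultimately have "?R = U" using U(1) unfolding component_set_def by blast
  then show "U \<subseteq> {v \<in> verts H. (adjacent H)\<^sup>*\<^sup>* w v}" using U(2) by blast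
qed

lemma components_simple:
  assumes "simple G"
  shows "components G = induced G ` {S. S \<subseteq> verts G \<and> component_set (edge_sets G) S}"
proof -
  have fin: "finite (verts G)" using assms by (simp add: simple_def multigraph_def)
  have cl: "closed_in (edge_sets G) (verts G)"
    by (rule closed_in_ground[OF edge_sets_subset_pairs[OF assms]])
  let ?r = "\<lambda>u. {v \<in> verts G. (adjacent G)\<^sup>*\<^sup>* u v}"
  have reach: "?r u = S" if "S \<subseteq> verts G" "component_set (edge_sets G) S" "u \<in> S" for u S
    using that assms by (intro reachable_eq_component_set) (auto simp: simple_def multigraph_def)
  have "components G = induced G ` ?r ` verts G" by (simp add: components_def image_image)
  also have "?r ` verts G = {S. S \<subseteq> verts G \<and> component_set (edge_sets G) S}"
  proof (intro set_eqI iffI)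
    fix S assume "S \<in> ?r ` verts G"
    then obtain u where u: "u \<in> verts G" "S = ?r u" by blast
    obtain U where "U \<subseteq> verts G" "u \<in> U" "component_set (edge_sets G) U"
      by (rule component_set_containing[OF fin cl u(1)])
    then show "S \<in> {S. S \<subseteq> verts G \<and> component_set (edge_sets G) S}"
      using reach[of U u] u(2) by simp
  next
    fix S assume S: "S \<in> {S. S \<subseteq> verts G \<and> component_set (edge_sets G) S}"
    then obtain u where "u \<in> S" by (auto simp: component_set_def)
    then show "S \<in> ?r ` verts G" using S reach[of S u] by blast
  qed
  finally show ?thesis .
qed

text \<open>The vertex \<open>xs ! j\<close> is the first end of the edge with index
  \<open>j\<close> and the second end of exactly one edge: the one with index \<open>j - 1\<close>,
  or the last one if \<open>j = 0\<close>.\<close>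

lemma degree_cycle:
  assumes "is_cycle C" "v \<in> verts C"
  shows "degree C v = 2"
proof -
  obtain xs where xs: "distinct xs" "length xs \<ge> 3" "verts C = set xs"
    "edges C = mset (map (\<lambda>i. {#xs ! i, xs ! (Suc i mod length xs)#}) [0..<length xs])"
    using assms(1) by (auto simp: is_cycle_def)
  let ?n = "length xs"
  obtain j where j: "j < ?n" "v = xs ! j" using assms(2) xs(3) by (metis in_set_conv_nth)
  have "degree C v = (\<Sum>i<?n. count {#xs ! i, xs ! (Suc i mod ?n)#} v)"
    unfolding degree_def xs(4)
    by (simp add: sum_mset_sum_list interv_sum_list_conv_sum_set_nat atLeast0LessThan flip: mset_map)
  also have "\<dots> = (\<Sum>i<?n. (if i = j then 1 else 0) + (if Suc i mod ?n = j then 1 else 0))"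
  proof (rule sum.cong[OF refl])
    fix i assume i: "i \<in> {..<?n}"
    then have "Suc i mod ?n < ?n" by (intro mod_less_divisor) auto
    then show "count {#xs ! i, xs ! (Suc i mod ?n)#} v = (if i = j then 1 else 0) + (if Suc i mod ?n = j then 1 else 0)"
      using i j xs(1) by (auto simp: nth_eq_iff_index_eq)
  qed
  also have "\<dots> = 1 + card {i \<in> {..<?n}. Suc i mod ?n = j}"
    using j(1) by (simp add: sum.distrib sum.If_cases Int_def)
  also have "{i \<in> {..<?n}. Suc i mod ?n = j} = {if j = 0 then ?n - 1 else j - 1}"
  proof (intro set_eqI iffI)
    fix i assume i: "i \<in> {i \<in> {..<?n}. Suc i mod ?n = j}"
    show "i \<in> {if j = 0 then ?n - 1 else j - 1}"
    proof (cases "Suc i = ?n")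
      case False
      then have "Suc i < ?n" using i by auto
      then show ?thesis using i by auto
    qed (use i in auto)
  next
    fix i assume "i \<in> {if j = 0 then ?n - 1 else j - 1}"
    then show "i \<in> {i \<in> {..<?n}. Suc i mod ?n = j}"
      using j(1) xs(2) by (cases "j = 0") auto
  qed
  finally show ?thesis by simp
qed

section \<open>Components under suppression\<close>

text \<open>\<open>S\<close> is a component of the original graph, and \<open>U\<close> consists of its vertices not yet suppressed.\<close>

definition suppression_inv ::
    "'a set \<Rightarrow> ('a \<Rightarrow> nat) \<Rightarrow> 'a multigraph \<Rightarrow> 'a set \<Rightarrow> bool" where
  "suppression_inv S \<delta> H U \<longleftrightarrow> U \<subseteq> S \<and> U \<subseteq> verts H \<and>
     (\<forall>e\<in>#edges H. set_mset e \<subseteq> U \<or> set_mset e \<inter> S = {}) \<and>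
     (\<forall>e\<in>#edges H. set_mset e \<inter> S \<noteq> {} \<longrightarrow> size e = 2) \<and>
     (\<forall>w\<in>U. degree H w = \<delta> w) \<and> component_set (edge_sets H) U"

section \<open>Edges and degrees after one suppression\<close>

lemma in_neighbours_iff:
  "x \<in># neighbours H v \<longleftrightarrow> (\<exists>e. e \<in># edges H \<and> v \<in># e \<and> x \<in># e - {#v#})"
  by (auto simp: neighbours_def)

lemma edges_suppress:
  "edges (suppress v H) = add_mset (neighbours H v) (filter_mset (\<lambda>e. v \<notin># e) (edges H))"
  by (simp add: suppress_def)

lemma in_edges_suppress:
  "e \<in># edges (suppress v H) \<longleftrightarrow> e = neighbours H v \<or> e \<in># edges H \<and> v \<notin># e"
  by (auto simp: edges_suppress)

lemma verts_suppress: "verts (suppress v H) = verts H - {v}"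
  by (simp add: suppress_def)

lemma count_sum_mset_image: "count (\<Sum>e\<in>#M. f e) w = (\<Sum>e\<in>#M. count (f e) w)"
  by (induction M) auto

lemma size_sum_mset_image:
  fixes f :: "'b \<Rightarrow> 'a multiset"
  shows "size (\<Sum>e\<in>#M. f e) = (\<Sum>e\<in>#M. size (f e))"
  by (induction M) auto

lemma sum_mset_filter_partition:
  fixes f :: "'b \<Rightarrow> nat"
  shows "(\<Sum>e\<in>#M. f e) = (\<Sum>e\<in># filter_mset P M. f e) + (\<Sum>e\<in># filter_mset (\<lambda>e. \<not> P e) M. f e)"
  by (induction M) auto

text \<open>The new edge contains \<open>w\<close> as often as the removed edges at \<open>v\<close>
  did together.\<close>

lemma degree_suppress:
  assumes "w \<noteq> v"
  shows "degree (suppress v H) w = degree H w"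
proof -
  have "count (neighbours H v) w = (\<Sum>e\<in># filter_mset (\<lambda>e. v \<in># e) (edges H). count e w)"
    using assms by (simp add: neighbours_def count_sum_mset_image)
  then have "degree (suppress v H) w
      = (\<Sum>e\<in># filter_mset (\<lambda>e. v \<in># e) (edges H). count e w) + (\<Sum>e\<in># filter_mset (\<lambda>e. v \<notin># e) (edges H). count e w)"
    by (simp add: degree_def edges_suppress)
  also have "\<dots> = degree H w"
    unfolding degree_def by (rule sum_mset_filter_partition[symmetric])
  finally show ?thesis .
qed

lemma degree_at: "degree H v = (\<Sum>e\<in># filter_mset (\<lambda>e. v \<in># e) (edges H). count e v)"
proof -
  have "degree H v = (\<Sum>e\<in># filter_mset (\<lambda>e. v \<in># e) (edges H). count e v)
      + (\<Sum>e\<in># filter_mset (\<lambda>e. v \<notin># e) (edges H). count e v)"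
    unfolding degree_def by (rule sum_mset_filter_partition)
  also have "(\<Sum>e\<in># filter_mset (\<lambda>e. v \<notin># e) (edges H). count e v) = 0"
    by (auto simp: sum_mset_0_iff not_in_iff)
  finally show ?thesis by simp
qed

text \<open>The edges at \<open>v\<close> avoid \<open>S\<close>, so the new edge avoids it too,
  whatever its size.\<close>

lemma suppression_inv_outside:
  assumes inv: "suppression_inv S \<delta> H U" and v: "v \<notin> S"
  shows "suppression_inv S \<delta> (suppress v H) U"
proof -
  have US: "U \<subseteq> S" and cl: "\<And>e. e \<in># edges H \<Longrightarrow> set_mset e \<subseteq> U \<or> set_mset e \<inter> S = {}"
    and comp: "component_set (edge_sets H) U"
    using inv by (auto simp: suppression_inv_def)
  have at_v: "set_mset e \<inter> S = {}" if "e \<in># edges H" "v \<in># e" for e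
    using cl[OF that(1)] that(2) US v by blast
  have nb: "set_mset (neighbours H v) \<inter> S = {}"
    using at_v by (fastforce simp: in_neighbours_iff dest: in_diffD)
  have cl': "set_mset e \<subseteq> U \<or> set_mset e \<inter> S = {}" if "e \<in># edges (suppress v H)" for e
    using that nb cl[of e] by (auto simp: in_edges_suppress)
  have "component_set (edge_sets (suppress v H)) U"
    unfolding component_set_def
  proof (intro conjI allI impI)
    show "U \<noteq> {}" using comp by (simp add: component_set_def)
    show "closed_in (edge_sets (suppress v H)) U"
      using cl' US unfolding closed_in_def edge_sets_def by blast
    fix T assume T: "T \<subseteq> U" "closed_in (edge_sets (suppress v H)) T"
    have "set_mset e \<subseteq> T \<or> set_mset e \<inter> T = {}" if "e \<in># edges H" for e
    proof (cases "v \<in># e")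
      case True
      then show ?thesis using at_v[OF that] T(1) US by blast
    next
      case False
      then have "e \<in># edges (suppress v H)" using that by (simp add: in_edges_suppress)
      then show ?thesis using T(2) by (simp add: closed_in_def edge_sets_def)
    qed
    then have "closed_in (edge_sets H) T" by (auto simp: closed_in_def edge_sets_def)
    then show "T = {} \<or> T = U" using comp T(1) by (auto simp: component_set_def)
  qed
  moreover have "degree (suppress v H) w = \<delta> w" if "w \<in> U" for w
    using degree_suppress[of w v H] inv that US v by (auto simp: suppression_inv_def)
  moreover have "size e = 2" if "e \<in># edges (suppress v H)" "set_mset e \<inter> S \<noteq> {}" for e
    using that nb inv by (auto simp: in_edges_suppress suppression_inv_def)
  moreover have "U \<subseteq> verts (suppress v H)"
    using inv US v by (auto simp: suppression_inv_def verts_suppress)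
  ultimately show ?thesis
    using US cl' unfolding suppression_inv_def by simp
qed

text \<open>A loop uses up the whole degree of \<open>v\<close>, so \<open>{v}\<close> would be
  closed and equal to \<open>U\<close>, which contains \<open>w\<close>.\<close>

lemma no_loop_at_degree_2:
  assumes comp: "component_set (edge_sets H) U" and v: "v \<in> U" "degree H v = 2"
    and w: "w \<in> U" "w \<noteq> v" and e: "e \<in># edges H" "v \<in># e" "size e = 2"
  shows "count e v = 1"
proof (rule ccontr)
  assume "count e v \<noteq> 1"
  then have "2 \<le> count e v" using e(2) by (metis One_nat_def Suc_leI count_greater_zero_iff le_neq_implies_less one_add_one plus_1_eq_Suc)
  have sz: "size (e - {#v#}) = 1" using e(2,3) by (simp add: size_Diff_singleton)
  then obtain y where "e - {#v#} = {#y#}" using size_1_singleton_mset by blast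
  then have "e = {#v, y#}" using e(2) by (metis insert_DiffM)
  then have ev: "e = {#v, v#}" using \<open>2 \<le> count e v\<close> by (auto split: if_splits)
  obtain M where M: "edges H = add_mset e M" using e(1) by (metis insert_DiffM)
  have "degree H v = count e v + (\<Sum>e\<in>#M. count e v)"
    unfolding degree_def M by simp
  then have 0: "(\<Sum>e\<in>#M. count e v) = 0" using v(2) \<open>2 \<le> count e v\<close> by linarith
  have "f = e" if "f \<in># edges H" "v \<in># f" for f
  proof (rule ccontr)
    assume "f \<noteq> e"
    then have "f \<in># M" using that(1) M by simp
    then have "count f v = 0" using 0 by (auto simp: sum_mset_0_iff)
    then show False using that(2) by (simp add: count_eq_zero_iff)
  qed
  then have "closed_in (edge_sets H) {v}"
    using ev unfolding closed_in_def edge_sets_def by fastforce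
  then have "{v} = U" using comp v(1) by (auto simp: component_set_def)
  then show False using w by blast
qed

text \<open>Since \<open>v\<close> has no loop, two edges lead from it to other vertices of
  \<open>U\<close>, and the new edge joins these. A set closed after suppression was closed before,
  once \<open>v\<close> is added in case the set meets the new edge; so minimality carries
  over.\<close>

lemma suppression_inv_inside:
  assumes inv: "suppression_inv S \<delta> H U" and v: "v \<in> U" "\<delta> v = 2" and w: "w \<in> U" "w \<noteq> v"
  shows "suppression_inv S \<delta> (suppress v H) (U - {v})"
proof -
  let ?nb = "neighbours H v"
  have US: "U \<subseteq> S" and cl: "\<And>e. e \<in># edges H \<Longrightarrow> set_mset e \<subseteq> U \<or> set_mset e \<inter> S = {}"
    and sz: "\<And>e. e \<in># edges H \<Longrightarrow> set_mset e \<inter> S \<noteq> {} \<Longrightarrow> size e = 2"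
    and comp: "component_set (edge_sets H) U" and dv: "degree H v = 2"
    using inv v by (auto simp: suppression_inv_def)
  have at_v: "set_mset e \<subseteq> U \<and> size e = 2 \<and> count e v = 1" if e: "e \<in># edges H" "v \<in># e" for e
  proof -
    have "set_mset e \<inter> S \<noteq> {}" using e(2) v(1) US by blast
    then have "set_mset e \<subseteq> U" "size e = 2" using cl[OF e(1)] sz[OF e(1)] by auto
    then show ?thesis using no_loop_at_degree_2[OF comp v(1) dv w e] by simp
  qed
  have nb: "set_mset ?nb \<subseteq> U - {v}"
  proof
    fix x assume "x \<in># ?nb"
    then obtain e where e: "e \<in># edges H" "v \<in># e" "x \<in># e - {#v#}" by (auto simp: in_neighbours_iff)
    have "x \<noteq> v" using at_v[OF e(1,2)] e(3) by (auto simp: in_diff_count)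
    then show "x \<in> U - {v}" using at_v[OF e(1,2)] e(3) by (auto dest: in_diffD)
  qed
  have edge_nb: "set_mset e \<subseteq> insert v (set_mset ?nb)" if "e \<in># edges H" "v \<in># e" for e
  proof
    fix x assume "x \<in># e"
    then have "x = v \<or> x \<in># e - {#v#}" by (cases "x = v") (auto simp: in_diff_count)
    then show "x \<in> insert v (set_mset ?nb)" using that by (auto simp: in_neighbours_iff)
  qed
  have "size ?nb = 2"
  proof -
    have "size ?nb = (\<Sum>e\<in># filter_mset (\<lambda>e. v \<in># e) (edges H). size (e - {#v#}))"
      unfolding neighbours_def by (rule size_sum_mset_image)
    also have "\<dots> = (\<Sum>e\<in># filter_mset (\<lambda>e. v \<in># e) (edges H). count e v)"
    proof (rule arg_cong[where f = sum_mset], rule image_mset_cong)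
      fix e assume "e \<in># filter_mset (\<lambda>e. v \<in># e) (edges H)"
      then show "size (e - {#v#}) = count e v" using at_v[of e] by (simp add: size_Diff_singleton)
    qed
    also have "\<dots> = degree H v" by (rule degree_at[symmetric])
    finally show ?thesis using dv by simp
  qed
  have cl': "set_mset e \<subseteq> U - {v} \<or> set_mset e \<inter> S = {}" if "e \<in># edges (suppress v H)" for e
    using that nb cl[of e] by (auto simp: in_edges_suppress)
  have "component_set (edge_sets (suppress v H)) (U - {v})"
    unfolding component_set_def
  proof (intro conjI allI impI)
    show "U - {v} \<noteq> {}" using w by blast
    show "closed_in (edge_sets (suppress v H)) (U - {v})"
      using cl' US unfolding closed_in_def edge_sets_def by blast
    fix T assume T: "T \<subseteq> U - {v}" "closed_in (edge_sets (suppress v H)) T"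
    have clT: "set_mset e \<subseteq> T \<or> set_mset e \<inter> T = {}" if "e \<in># edges (suppress v H)" for e
      using T(2) that by (simp add: closed_in_def edge_sets_def)
    have off_v: "set_mset e \<subseteq> T \<or> set_mset e \<inter> T = {}" if "e \<in># edges H" "v \<notin># e" for e
      using clT[of e] that by (simp add: in_edges_suppress)
    show "T = {} \<or> T = U - {v}"
    proof (cases "set_mset ?nb \<inter> T = {}")
      case False
      then have nbT: "set_mset ?nb \<subseteq> T" using clT[of ?nb] by (simp add: in_edges_suppress)
      have "set_mset e \<subseteq> insert v T \<or> set_mset e \<inter> insert v T = {}" if "e \<in># edges H" for e
      proof (cases "v \<in># e")
        case True
        then show ?thesis using edge_nb[OF that] nbT by blast
      next
        case False
        then show ?thesis using off_v[OF that] by blast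
      qed
      then have "closed_in (edge_sets H) (insert v T)" by (auto simp: closed_in_def edge_sets_def)
      moreover have "insert v T \<subseteq> U" using T(1) v(1) by blast
      ultimately have "insert v T = U" using comp unfolding component_set_def by blast
      then show ?thesis using T(1) by blast
    next
      case True
      have "set_mset e \<subseteq> T \<or> set_mset e \<inter> T = {}" if "e \<in># edges H" for e
      proof (cases "v \<in># e")
        case True
        then show ?thesis using edge_nb[OF that] \<open>set_mset ?nb \<inter> T = {}\<close> T(1) by blast
      qed (use off_v[OF that] in blast)
      then have "closed_in (edge_sets H) T" by (auto simp: closed_in_def edge_sets_def)
      moreover have "T \<subseteq> U" using T(1) by blast
      ultimately have "T = {} \<or> T = U" using comp unfolding component_set_def by blast
      then show ?thesis using T(1) v(1) by blast
    qed
  qed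
  moreover have "degree (suppress v H) u = \<delta> u" if "u \<in> U - {v}" for u
    using degree_suppress[of u v H] inv that by (auto simp: suppression_inv_def)
  moreover have "size e = 2" if "e \<in># edges (suppress v H)" "set_mset e \<inter> S \<noteq> {}" for e
    using that \<open>size ?nb = 2\<close> sz by (auto simp: in_edges_suppress)
  moreover have "U - {v} \<subseteq> S" "U - {v} \<subseteq> verts (suppress v H)"
    using inv by (auto simp: suppression_inv_def verts_suppress)
  ultimately show ?thesis
    using cl' unfolding suppression_inv_def by simp
qed

text \<open>The vertex \<open>w\<close> is never suppressed and so remains available as the second
  vertex that \<open>suppression_inv_inside\<close> asks for.\<close>

lemma suppression_inv_fold:
  assumes "suppression_inv S \<delta> H U" "distinct vs" "\<And>v. v \<in> set vs \<Longrightarrow> v \<in> S \<Longrightarrow> v \<in> U \<and> \<delta> v = 2"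
    and "w \<in> U" "w \<notin> set vs"
  shows "suppression_inv S \<delta> (fold suppress vs H) (U - set vs)"
  using assms
proof (induction vs arbitrary: H U)
  case (Cons v vs)
  show ?case
  proof (cases "v \<in> S")
    case True
    then have "suppression_inv S \<delta> (suppress v H) (U - {v})"
      using Cons.prems by (intro suppression_inv_inside[of _ _ _ _ _ w]) auto
    then have "suppression_inv S \<delta> (fold suppress vs (suppress v H)) (U - {v} - set vs)"
      using Cons.prems by (intro Cons.IH) auto
    moreover have "U - {v} - set vs = U - set (v # vs)" by auto
    ultimately show ?thesis by simp
  next
    case False
    then have "suppression_inv S \<delta> (suppress v H) U"
      using Cons.prems by (intro suppression_inv_outside) auto
    then have "suppression_inv S \<delta> (fold suppress vs (suppress v H)) (U - set vs)"
      using Cons.prems by (intro Cons.IH) auto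
    moreover have "v \<notin> U" using False Cons.prems(1) by (auto simp: suppression_inv_def)
    then have "U - set vs = U - set (v # vs)" by auto
    ultimately show ?thesis by simp
  qed
qed simp

text \<open>Outside the component that is followed, a 2-regular component that has not been deleted may be
suppressed down to a loop and then to an edge with a single end; but the empty edge, which would be
contained in every vertex set, never arises.\<close>

definition well_sized :: "'a multigraph \<Rightarrow> 'a set \<Rightarrow> bool" where
  "well_sized H R \<longleftrightarrow> (\<forall>e\<in>#edges H. e \<noteq> {#} \<and> (size e = 2 \<or> set_mset e \<inter> R = {})) \<and>
     (\<forall>v\<in>R. degree H v = 2)"

text \<open>Either \<open>v\<close> has two edges without a loop, and the new edge has size 2, or it
  has a single loop, and the new edge is \<open>{#v#}\<close>, which avoids
  \<open>R - {v}\<close>.\<close>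

lemma well_sized_suppress:
  assumes ws: "well_sized H R" and v: "v \<in> R"
  shows "well_sized (suppress v H) (R - {v})"
proof -
  let ?nb = "neighbours H v" and ?F = "filter_mset (\<lambda>e. v \<in># e) (edges H)"
  have at_v: "size e = 2" if "e \<in># ?F" for e
    using that ws v by (auto simp: well_sized_def)
  have deg: "(\<Sum>e\<in>#?F. count e v) = 2" using ws v degree_at[of H v] by (simp add: well_sized_def)
  have "size ?nb = (\<Sum>e\<in>#?F. size (e - {#v#}))"
    unfolding neighbours_def by (rule size_sum_mset_image)
  also have "\<dots> = (\<Sum>e\<in>#?F. 1)"
  proof (rule arg_cong[where f = sum_mset], rule image_mset_cong)
    fix e assume "e \<in># ?F"
    then show "size (e - {#v#}) = 1" using at_v[of e] by (simp add: size_Diff_singleton)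
  qed
  finally have size_nb: "size ?nb = size ?F" by simp
  have "?nb \<noteq> {#} \<and> (size ?nb = 2 \<or> set_mset ?nb \<inter> (R - {v}) = {})"
  proof -
    have "(\<Sum>e\<in>#?F. 1) \<le> (\<Sum>e\<in>#?F. count e v)"
      by (intro sum_mset_mono) (simp add: Suc_leI)
    then have "size ?F \<le> 2" using deg by simp
    moreover have "?F \<noteq> {#}"
    proof
      assume F: "?F = {#}"
      show False using deg unfolding F by simp
    qed
    ultimately consider "size ?F = 1" | "size ?F = 2"
      by (metis One_nat_def le_Suc_eq le_zero_eq numeral_2_eq_2 size_eq_0_iff_empty)
    then show ?thesis
    proof cases
      case 1
      then obtain e where e: "?F = {#e#}" using size_1_singleton_mset by blast
      have "count e v = 2" using deg unfolding e by simp
      moreover have "size e = 2" using at_v e by simp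
      moreover have "size (e - replicate_mset 2 v) = size e - 2"
        using calculation by (subst size_Diff_submset) (auto simp: count_le_replicate_mset_subset_eq[symmetric])
      ultimately have "e = replicate_mset 2 v"
        by (metis count_le_replicate_mset_subset_eq diff_self_eq_0 le_refl size_eq_0_iff_empty subset_mset.diff_add add.left_neutral)
      then have "?nb = {#v#}" unfolding neighbours_def e by (simp add: numeral_2_eq_2)
      then show ?thesis by simp
    next
      case 2
      then show ?thesis using size_nb by auto
    qed
  qed
  moreover have "e \<noteq> {#} \<and> (size e = 2 \<or> set_mset e \<inter> (R - {v}) = {})" if "e \<in># edges H" for e
  proof -
    have "e \<noteq> {#} \<and> (size e = 2 \<or> set_mset e \<inter> R = {})"
      using ws that by (simp add: well_sized_def)
    then show ?thesis by blast
  qed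
  ultimately have "e \<noteq> {#} \<and> (size e = 2 \<or> set_mset e \<inter> (R - {v}) = {})"
    if "e \<in># edges (suppress v H)" for e
    using that by (cases "e = ?nb") (auto simp only: in_edges_suppress)
  moreover have "degree (suppress v H) w = 2" if "w \<in> R - {v}" for w
    using ws that degree_suppress[of w v H] by (auto simp: well_sized_def)
  ultimately show ?thesis
    unfolding well_sized_def by simp
qed

lemma well_sized_fold:
  "well_sized H (set vs) \<Longrightarrow> distinct vs \<Longrightarrow> well_sized (fold suppress vs H) {}"
proof (induction vs arbitrary: H)
  case (Cons v vs)
  have "well_sized (suppress v H) (set (v # vs) - {v})"
    using Cons.prems by (intro well_sized_suppress) auto
  then have "well_sized (suppress v H) (set vs)" using Cons.prems(2) by simp
  then show ?case using Cons by simp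
qed simp

lemma sum_degree_induced:
  assumes "finite U" "\<And>e. e \<in># edges H \<Longrightarrow> set_mset e \<subseteq> U \<or> set_mset e \<inter> U = {}"
    and "\<And>e. e \<in># edges H \<Longrightarrow> set_mset e \<subseteq> U \<Longrightarrow> size e = 2"
  shows "(\<Sum>w\<in>U. degree H w) = 2 * size (edges (induced H U))"
proof -
  have "(\<Sum>w\<in>U. \<Sum>e\<in>#M. count e w) = (\<Sum>e\<in>#M. \<Sum>w\<in>U. count e w)" for M :: "'a multiset multiset"
    by (induction M) (auto simp: sum.distrib)
  then have "(\<Sum>w\<in>U. degree H w) = (\<Sum>e\<in>#edges H. \<Sum>w\<in>U. count e w)"
    by (simp add: degree_def)
  also have "\<dots> = (\<Sum>e\<in>#edges H. if set_mset e \<subseteq> U then 2 else 0)"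
  proof (rule arg_cong[where f = sum_mset], rule image_mset_cong)
    fix e assume e: "e \<in># edges H"
    show "(\<Sum>w\<in>U. count e w) = (if set_mset e \<subseteq> U then 2 else 0)"
    proof (cases "set_mset e \<subseteq> U")
      case True
      then have "(\<Sum>w\<in>U. count e w) = size e"
        using assms(1) unfolding size_multiset_overloaded_eq
        by (intro sum.mono_neutral_right) (auto simp: not_in_iff)
      then show ?thesis using True assms(3)[OF e] by simp
    next
      case False
      then have "set_mset e \<inter> U = {}" using assms(2)[OF e] by blast
      then have "(\<Sum>w\<in>U. count e w) = 0"
        by (intro sum.neutral) (auto simp: count_eq_zero_iff disjoint_iff)
      then show ?thesis using False by simp
    qed
  qed
  also have "\<dots> = 2 * size {#e \<in># edges H. set_mset e \<subseteq> U#}"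
  proof -
    have "(\<Sum>e\<in>#M. if P e then 2 else 0) = 2 * size (filter_mset P M)"
      for M :: "'a multiset multiset" and P by (induction M) auto
    then show ?thesis .
  qed
  finally show ?thesis by (simp add: induced_def)
qed

text \<open>The size is found by the handshake lemma on \<open>U\<close>. An empty edge would be
  counted in \<open>induced H U\<close> without contributing to any degree, which \<open>ne\<close>
  excludes.\<close>

lemma suppression_inv_component:
  assumes inv: "suppression_inv S \<delta> H U" and S: "finite S" and ne: "{#} \<notin># edges H"
  obtains C where "C \<in> components H" "2 * size (edges C) = sum \<delta> U"
proof -
  have US: "U \<subseteq> S" and UH: "U \<subseteq> verts H"
    and cl: "\<And>e. e \<in># edges H \<Longrightarrow> set_mset e \<subseteq> U \<or> set_mset e \<inter> S = {}"
    and sz: "\<And>e. e \<in># edges H \<Longrightarrow> set_mset e \<inter> S \<noteq> {} \<Longrightarrow> size e = 2"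
    and comp: "component_set (edge_sets H) U" and deg: "\<And>w. w \<in> U \<Longrightarrow> degree H w = \<delta> w"
    using inv by (auto simp: suppression_inv_def)
  obtain w where w: "w \<in> U" using comp by (auto simp: component_set_def)
  have "{v \<in> verts H. (adjacent H)\<^sup>*\<^sup>* w v} = U"
    by (rule reachable_eq_component_set[OF comp UH w]) (use sz US in blast)
  then have "induced H U \<in> components H"
    using w UH unfolding components_def by blast
  moreover have "2 * size (edges (induced H U)) = sum (degree H) U"
  proof (rule sum_degree_induced[symmetric])
    show "finite U" using finite_subset[OF US S] .
    show "set_mset e \<subseteq> U \<or> set_mset e \<inter> U = {}" if "e \<in># edges H" for e
      using cl[OF that] US by blast
    show "size e = 2" if "e \<in># edges H" "set_mset e \<subseteq> U" for e
    proof -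
      have "e \<noteq> {#}" using that(1) ne by blast
      then have "set_mset e \<inter> S \<noteq> {}" using that(2) US by auto
      then show ?thesis using sz[OF that(1)] by blast
    qed
  qed
  moreover have "sum (degree H) U = sum \<delta> U" using deg by (intro sum.cong) auto
  ultimately show ?thesis using that by simp
qed

section \<open>The theorem\<close>

lemma degree_induced:
  assumes "\<And>e. e \<in># edges G \<Longrightarrow> w \<in># e \<Longrightarrow> set_mset e \<subseteq> T"
  shows "degree (induced G T) w = degree G w"
proof -
  have "filter_mset (\<lambda>e. w \<in># e) (edges (induced G T)) = filter_mset (\<lambda>e. w \<in># e) (edges G)"
    unfolding induced_def using assms by (auto simp: filter_filter_mset intro: filter_mset_cong)
  then show ?thesis by (simp only: degree_at)
qed

text \<open>The vertex \<open>w\<close> shows that \<open>S\<close> is not a cycle, so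
  \<open>S\<close> survives the deletion, and \<open>w\<close> survives the suppressions. The
  invariant starts with all of \<open>S\<close> and ends with its vertices of degree other than 2,
  whose degrees are unchanged.\<close>

lemma suppressed_component:
  fixes G :: "'a::linorder multigraph"
  assumes G: "simple G" and S: "S \<subseteq> verts G" "component_set (edge_sets G) S"
    and w: "w \<in> S" "degree G w \<noteq> 2"
  obtains C where "C \<in> components (suppressed G)"
    "2 * size (edges C) = sum (degree G) {v \<in> S. degree G v \<noteq> 2}"
proof -
  define Cyc where "Cyc = \<Union> (verts ` {C \<in> components G. is_cycle C})"
  define G' where "G' = delete_cyclic G"
  have G': "G' = induced G (verts G - Cyc)" by (simp add: G'_def delete_cyclic_def Cyc_def)
  have fin: "finite (verts G)" using G by (simp add: simple_def multigraph_def)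
  have cl: "set_mset e \<subseteq> S \<or> set_mset e \<inter> S = {}" if "e \<in># edges G" for e
    using S(2) that by (auto simp: component_set_def closed_in_def edge_sets_def)
  have edge: "e \<noteq> {#} \<and> size e = 2" if e: "e \<in># edges G" for e
    using G e by (auto simp: simple_def multigraph_def)
  \<comment> \<open>A cyclic component meeting \<open>S\<close> would be \<open>S\<close> itself,
    and then \<open>w\<close> would have degree 2.\<close>
  have "S \<inter> Cyc = {}"
  proof (rule ccontr)
    assume "S \<inter> Cyc \<noteq> {}"
    then obtain C where C: "C \<in> components G" "is_cycle C" "S \<inter> verts C \<noteq> {}"
      by (auto simp: Cyc_def)
    then obtain T where T: "T \<subseteq> verts G" "component_set (edge_sets G) T" "C = induced G T"
      using components_simple[OF G] by blast
    have vC: "verts C = T" using T(1) by (auto simp: T(3) induced_def)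
    then have "S = T" using component_sets_disjoint[OF S(2) T(2)] C(3) by blast
    then have "degree C w = 2" using degree_cycle[OF C(2)] vC w(1) by simp
    moreover have "degree C w = degree G w"
      unfolding T(3)
    proof (rule degree_induced)
      fix e assume "e \<in># edges G" "w \<in># e"
      then show "set_mset e \<subseteq> T" using cl[of e] w(1) \<open>S = T\<close> by blast
    qed
    ultimately show False using w(2) by simp
  qed
  then have SW: "S \<subseteq> verts G - Cyc" using S(1) by blast
  have deg': "degree G' v = degree G v" if v: "v \<in> S" for v
    unfolding G'
  proof (rule degree_induced)
    fix e assume "e \<in># edges G" "v \<in># e"
    then show "set_mset e \<subseteq> verts G - Cyc" using cl[of e] v SW by blast
  qed
  have edges': "e \<in># edges G' \<longleftrightarrow> e \<in># edges G \<and> set_mset e \<subseteq> verts G - Cyc" for e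
    by (simp add: G' induced_def)
  have verts': "verts G' = verts G - Cyc" by (auto simp: G' induced_def)
  have "component_set (edge_sets G') S"
    unfolding component_set_def
  proof (intro conjI allI impI)
    show "S \<noteq> {}" using w by blast
    show "closed_in (edge_sets G') S"
      using cl edges' by (auto simp: closed_in_def edge_sets_def)
    fix T assume T: "T \<subseteq> S" "closed_in (edge_sets G') T"
    have "set_mset e \<subseteq> T \<or> set_mset e \<inter> T = {}" if e: "e \<in># edges G" for e
    proof (cases "set_mset e \<subseteq> S")
      case True
      then have "e \<in># edges G'" using e SW edges' by blast
      then show ?thesis using T(2) by (simp add: closed_in_def edge_sets_def)
    next
      case False
      then show ?thesis using cl[OF e] T(1) by blast
    qed
    then have "closed_in (edge_sets G) T" by (auto simp: closed_in_def edge_sets_def)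
    then show "T = {} \<or> T = S" using S(2) T(1) by (simp add: component_set_def)
  qed
  moreover have "set_mset e \<subseteq> S \<or> set_mset e \<inter> S = {}" "size e = 2" if "e \<in># edges G'" for e
    using that cl[of e] edge[of e] edges' by auto
  ultimately have inv: "suppression_inv S (degree G) G' S"
    unfolding suppression_inv_def using deg' SW verts' by simp
  define vs where "vs = sorted_list_of_set {v \<in> verts G'. degree G' v = 2}"
  have vs: "distinct vs" "set vs = {v \<in> verts G'. degree G' v = 2}"
    using fin by (simp_all add: vs_def verts')
  have sup: "suppressed G = fold suppress vs G'"
    by (simp add: suppressed_def G'_def vs_def Let_def)
  have "well_sized G' (set vs)"
    using edge edges' vs(2) by (simp add: well_sized_def)
  then have "well_sized (suppressed G) {}" using well_sized_fold vs(1) sup by metis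
  then have ne: "{#} \<notin># edges (suppressed G)" by (auto simp: well_sized_def)
  have "suppression_inv S (degree G) (suppressed G) (S - set vs)"
    unfolding sup
  proof (rule suppression_inv_fold[OF inv vs(1)])
    show "v \<in> S \<and> degree G v = 2" if "v \<in> set vs" "v \<in> S" for v
      using that vs(2) deg' by auto
    show "w \<in> S" by fact
    show "w \<notin> set vs" using w deg' vs(2) by auto
  qed
  then obtain C where "C \<in> components (suppressed G)" "2 * size (edges C) = sum (degree G) (S - set vs)"
    using suppression_inv_component finite_subset[OF S(1) fin] ne by metis
  moreover have "S - set vs = {v \<in> S. degree G v \<noteq> 2}"
    using vs(2) deg' SW verts' by auto
  ultimately show ?thesis using that by simp
qed

text \<open>Take a maximal closed set with at most half of the total degree. If it had less than a
  quarter, a further component, with at most a quarter, could be added.\<close>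

lemma balanced_closed_exists:
  assumes V: "finite V" and E: "E \<in> realizations V d"
    and small: "\<And>S. S \<subseteq> V \<Longrightarrow> component_set E S \<Longrightarrow> 4 * sum d S \<le> sum d V"
  obtains A where "balanced V d A" "closed_in E A"
proof -
  have sub: "E \<subseteq> pairs V" using E by (simp add: realizations_def)
  let ?F = "{A. A \<subseteq> V \<and> closed_in E A \<and> 2 * sum d A \<le> sum d V}"
  have "finite ?F" by (rule finite_subset[of _ "Pow V"]) (use V in auto)
  moreover have "{} \<in> ?F" by (simp add: closed_in_def)
  then have "?F \<noteq> {}" by (metis empty_iff)
  ultimately obtain A where A: "A \<in> ?F" "\<forall>B\<in>?F. A \<subseteq> B \<longrightarrow> A = B"
    by (elim finite_has_maximal[THEN bexE])
  have AV: "A \<subseteq> V" "closed_in E A" "2 * sum d A \<le> sum d V" using A(1) by auto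
  have sumV: "sum d V = sum d A + sum d (V - A)"
    using sum.subset_diff[OF AV(1) V] by (simp add: add.commute)
  have "sum d V \<le> 4 * sum d A"
  proof (rule ccontr)
    assume less: "\<not> ?thesis"
    have "V - A \<noteq> {}"
    proof
      assume "V - A = {}"
      with sumV have "sum d V = sum d A" by (simp only: sum.empty)
      then show False using less by simp
    qed
    moreover have "closed_in E (V - A)"
      by (rule closed_in_Diff[OF closed_in_ground[OF sub] AV(2)])
    ultimately obtain S where S: "S \<subseteq> V - A" "component_set E S"
      using component_set_exists[of "V - A" E] V by blast
    have "sum d (A \<union> S) = sum d A + sum d S"
      using S(1) AV(1) V by (intro sum.union_disjoint) (auto intro: finite_subset)
    moreover have "4 * sum d S \<le> sum d V" using small S by blast
    ultimately have "2 * sum d (A \<union> S) \<le> sum d V" using less by linarith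
    moreover have "closed_in E (A \<union> S)"
      using AV(2) S(2) by (intro closed_in_Un) (simp_all add: component_set_def)
    ultimately have mem: "A \<union> S \<in> ?F" using S(1) AV(1) by blast
    have "A = A \<union> S" using mp[OF bspec[OF A(2) mem]] by blast
    then show False using S by (auto simp: component_set_def)
  qed
  moreover have "sum d V \<le> 4 * sum d (V - A)" using AV(3) sumV by linarith
  ultimately show ?thesis using that AV by (simp add: balanced_def)
qed

text \<open>The bad event in terms of edge sets. Cyclic components, which \<open>suppressed\<close>
  deletes, have branch weight 0 and meet the second condition for positive
  \<open>\<mu>\<close>.\<close>

definition no_heavy_component :: "'a set \<Rightarrow> ('a \<Rightarrow> nat) \<Rightarrow> real \<Rightarrow> real \<Rightarrow> 'a set set \<Rightarrow> bool" where
  "no_heavy_component V d s \<mu> E \<longleftrightarrow>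
     (\<exists>S\<subseteq>V. component_set E S \<and> s \<le> real (card S)) \<and>
     (\<forall>S\<subseteq>V. component_set E S \<longrightarrow> real (branch_weight d S) < \<mu>)"

text \<open>Every vertex of degree other than 2 adds at least 1 to the branch weight, so a component
  of order \<open>\<gamma> * n\<close> and branch weight below
  \<open>\<mu> <= \<gamma> * n / 2\<close> has at least
  \<open>\<gamma> * n / 2 = 2 * \<theta>\<close> vertices of degree 2, and
  \<open>card_large_light_component_le\<close> applies.\<close>

lemma card_no_heavy_sparse:
  fixes \<gamma> \<rho> :: real
  assumes V: "finite V" and d: "\<And>v. v \<in> V \<Longrightarrow> d v > 0"
    and \<gamma>: "0 < \<gamma>" "16 \<le> \<gamma> * real (card V)" and \<rho>: "0 < \<rho>" "\<rho> \<le> 1 / 10" "\<rho> \<le> \<gamma> / 5000"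
    and M: "16 \<le> branch_weight d V" "branch_weight d V \<le> 200 * card V"
  shows "real (card {E \<in> realizations V d.
      no_heavy_component V d (\<gamma> * real (card V)) (2 * \<rho> * real (branch_weight d V)) E})
      * (\<gamma>\<^sup>2 * real (branch_weight d V)) \<le> 512 * real (card (realizations V d))"
proof -
  define n where "n = real (card V)"
  define m where "m = real (branch_weight d V)"
  define h where "h = m / n"
  define \<theta> where "\<theta> = \<gamma> * n / 4"
  define \<mu> where "\<mu> = 2 * \<rho> * m"
  have n: "n > 0" using \<gamma> unfolding n_def by (cases "card V = 0") auto
  have m: "16 \<le> m" "m \<le> 200 * n" using M unfolding m_def n_def by linarith+
  have h: "0 < h" "h \<le> 200" "16 \<le> h * n" and hn: "m = h * n"
    using n m by (auto simp: h_def field_simps)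
  \<comment> \<open>The value \<open>\<gamma> / 5000\<close> is chosen so that \<open>\<mu>\<close>
    is at most \<open>h * \<theta> / 625\<close>, which equals
    \<open>\<gamma> * m / 2500\<close>.\<close>
  have "2 * \<rho> * m \<le> 2 * (\<gamma> / 5000) * m" using \<rho> m by (intro mult_right_mono) auto
  then have \<mu>1: "\<mu> \<le> \<gamma> * m / 2500" by (simp add: \<mu>_def)
  then have \<mu>2: "\<mu> \<le> h * \<theta> / 625" using n by (simp add: h_def \<theta>_def mult.commute)
  have "\<rho> * m \<le> 1 / 10 * m" using \<rho> m by (intro mult_right_mono) auto
  then have \<mu>3: "\<mu> \<le> h * n / 4" using m unfolding hn[symmetric] \<mu>_def by linarith
  have \<mu>0: "0 \<le> \<mu>" using \<rho> m by (simp add: \<mu>_def)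
  have "\<gamma> * m \<le> \<gamma> * (200 * n)" using \<gamma> m by (intro mult_left_mono) auto
  then have \<mu>n: "\<mu> \<le> 2 * \<theta>" using \<mu>1 \<gamma> unfolding \<theta>_def n_def by argo
  let ?Light = "{E \<in> realizations V d. \<exists>S\<subseteq>V. component_set E S \<and>
      real (branch_weight d S) < \<mu> \<and> 2 * \<theta> \<le> real (card {v \<in> S. d v = 2})}"
  have "{E \<in> realizations V d. no_heavy_component V d (\<gamma> * n) \<mu> E} \<subseteq> ?Light"
  proof clarify
    fix E assume E: "E \<in> realizations V d" "no_heavy_component V d (\<gamma> * n) \<mu> E"
    then obtain S where S: "S \<subseteq> V" "component_set E S" "\<gamma> * n \<le> real (card S)"
      and light: "real (branch_weight d S) < \<mu>"
      unfolding no_heavy_component_def by blast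
    have finS: "finite S" using S(1) V finite_subset by blast
    have "card {v \<in> S. d v \<noteq> 2} = (\<Sum>v\<in>{v \<in> S. d v \<noteq> 2}. 1)" by simp
    also have "\<dots> \<le> branch_weight d S"
      unfolding branch_weight_def using d S(1) by (intro sum_mono) (auto simp: Suc_le_eq)
    finally have le: "card {v \<in> S. d v \<noteq> 2} \<le> branch_weight d S" .
    have "card S = card ({v \<in> S. d v = 2} \<union> {v \<in> S. d v \<noteq> 2})" by (rule arg_cong[where f = card]) auto
    also have "\<dots> = card {v \<in> S. d v = 2} + card {v \<in> S. d v \<noteq> 2}"
      using finS by (intro card_Un_disjoint) auto
    finally have "real (card S) \<le> real (card {v \<in> S. d v = 2}) + \<mu>" using le light by linarith
    then have "2 * \<theta> \<le> real (card {v \<in> S. d v = 2})"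
      using S(3) \<mu>n by (simp add: \<theta>_def)
    then show "\<exists>S\<subseteq>V. component_set E S \<and>
      real (branch_weight d S) < \<mu> \<and> 2 * \<theta> \<le> real (card {v \<in> S. d v = 2})"
      using S light by blast
  qed
  then have "card {E \<in> realizations V d. no_heavy_component V d (\<gamma> * n) \<mu> E} \<le> card ?Light"
    by (rule card_mono[rotated]) (simp add: finite_realizations[OF V])
  then have "real (card {E \<in> realizations V d. no_heavy_component V d (\<gamma> * n) \<mu> E}) * (\<theta> * (\<theta> * h / 32))
      \<le> real (card ?Light) * (\<theta> * (\<theta> * h / 32))"
    using \<gamma> h n by (intro mult_right_mono) (auto simp: \<theta>_def)
  also have "\<dots> \<le> n * real (card (realizations V d))"
  proof (rule card_large_light_component_le[OF V])
    show "card V > 0" using n by (simp add: n_def)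
    show "real (branch_weight d V) = h * n" using hn m_def by simp
    show "4 \<le> \<theta>" using \<gamma> by (simp add: \<theta>_def n_def)
  qed (use n_def h \<mu>0 \<mu>2 \<mu>3 in simp_all)
  also have "\<theta> * (\<theta> * h / 32) = n * (\<gamma>\<^sup>2 * m / 512)"
    using n by (simp add: \<theta>_def h_def power2_eq_square)
  finally have "n * (real (card {E \<in> realizations V d. no_heavy_component V d (\<gamma> * n) \<mu> E}) * (\<gamma>\<^sup>2 * m / 512))
      \<le> n * real (card (realizations V d))" by (simp add: algebra_simps)
  then have "real (card {E \<in> realizations V d. no_heavy_component V d (\<gamma> * n) \<mu> E}) * (\<gamma>\<^sup>2 * m / 512)
      \<le> real (card (realizations V d))" using n by (subst (asm) mult_le_cancel_left_pos)
  then show ?thesis unfolding n_def m_def \<mu>_def by simp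
qed

text \<open>Let \<open>m\<close> be the branch weight of \<open>V\<close>. A component has branch
  weight at most \<open>m / 5\<close>, and its vertices of degree 2 add at most
  \<open>2 * card V <= m / 100\<close>. So it has less than a quarter of the total degree, and a
  balanced closed set exists.\<close>

lemma card_no_heavy_dense:
  fixes \<rho> :: real
  assumes V: "finite V" "card V > 0" and \<rho>: "0 < \<rho>" "\<rho> \<le> 1 / 10"
    and M: "200 * card V \<le> branch_weight d V" and t: "441 * t\<^sup>2 \<le> branch_weight d V" "2 * t \<le> card V"
  shows "real (card {E \<in> realizations V d.
      no_heavy_component V d s (2 * \<rho> * real (branch_weight d V)) E})
      \<le> (2 * real t + 1) / 4 ^ t * real (card (realizations V d))"
proof -
  let ?m = "branch_weight d V"
  have W: "?m \<le> sum d V" unfolding branch_weight_def using V by (intro sum_mono2) auto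
  have "{E \<in> realizations V d. no_heavy_component V d s (2 * \<rho> * real ?m) E}
      \<subseteq> {E \<in> realizations V d. \<exists>A. balanced V d A \<and> closed_in E A}"
  proof clarify
    fix E assume E: "E \<in> realizations V d" "no_heavy_component V d s (2 * \<rho> * real ?m) E"
    have "4 * sum d S \<le> sum d V" if S: "S \<subseteq> V" "component_set E S" for S
    proof -
      have "\<rho> * real ?m \<le> 1 / 10 * real ?m" using \<rho> by (intro mult_right_mono) auto
      moreover have "real (branch_weight d S) < 2 * \<rho> * real ?m"
        using E(2) S unfolding no_heavy_component_def by blast
      ultimately have "real (branch_weight d S) \<le> real ?m / 5" by linarith
      moreover have "card {v \<in> S. d v = 2} \<le> card V" using S(1) V(1) by (intro card_mono) auto
      then have "real (card {v \<in> S. d v = 2}) \<le> real (card V)" by simp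
      moreover have "200 * real (card V) \<le> real ?m" using M by linarith
      moreover have "0 \<le> real ?m" by simp
      ultimately have "4 * (real (branch_weight d S) + 2 * real (card {v \<in> S. d v = 2})) \<le> real ?m"
        by argo
      then have "real (4 * (branch_weight d S + 2 * card {v \<in> S. d v = 2})) \<le> real ?m" by simp
      then have "4 * (branch_weight d S + 2 * card {v \<in> S. d v = 2}) \<le> ?m"
        by (simp only: of_nat_le_iff)
      then show ?thesis
        unfolding sum_branch_weight[OF finite_subset[OF S(1) V(1)], of d] using W by (rule order_trans)
    qed
    then show "\<exists>A. balanced V d A \<and> closed_in E A"
      using balanced_closed_exists[OF V(1) E(1)] by metis
  qed
  then have "card {E \<in> realizations V d. no_heavy_component V d s (2 * \<rho> * real ?m) E}
      \<le> card {E \<in> realizations V d. \<exists>A. balanced V d A \<and> closed_in E A}"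
    by (rule card_mono[rotated]) (simp add: finite_realizations[OF V(1)])
  also have "real \<dots> \<le> (2 * real t + 1) / 4 ^ t * real (card (realizations V d))"
    using M W t V by (intro card_balanced_split_le) auto
  finally show ?thesis by simp
qed

text \<open>A component with a vertex of degree other than 2 reappears after suppression with half
  its branch weight as size; any other component has branch weight 0, below the positive
  bound.\<close>

lemma bad_event_no_heavy_component:
  assumes d: "degree_sequence n d" and M: "0 < M_deg n d" and \<rho>: "0 < \<rho>"
    and G: "G \<in> graphs_with_degrees n d"
    and large: "\<exists>C \<in> components G. \<gamma> * real n \<le> real (card (verts C))"
    and small: "\<not> (\<exists>C \<in> components (suppressed G). \<rho> * real (M_deg n d) \<le> real (size (edges C)))"
  shows "no_heavy_component {1..n} d (\<gamma> * real n) (2 * \<rho> * real (M_deg n d)) (edge_sets G)"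
  unfolding no_heavy_component_def
proof (intro conjI allI impI)
  have simple: "simple G" and V: "verts G = {1..n}" and deg: "\<And>i. i \<in> {1..n} \<Longrightarrow> degree G i = d i"
    using G by (auto simp: graphs_with_degrees_def)
  obtain C where C: "C \<in> components G" "\<gamma> * real n \<le> real (card (verts C))" using large by blast
  then obtain S where S: "S \<subseteq> verts G" "component_set (edge_sets G) S" "C = induced G S"
    using components_simple[OF simple] by blast
  have "verts C = S" using S(1) by (auto simp: S(3) induced_def)
  then show "\<exists>S\<subseteq>{1..n}. component_set (edge_sets G) S \<and> \<gamma> * real n \<le> real (card S)"
    using S C(2) V by auto
  fix S assume S: "S \<subseteq> {1..n}" "component_set (edge_sets G) S"
  show "real (branch_weight d S) < 2 * \<rho> * real (M_deg n d)"
  proof (cases "\<exists>w\<in>S. d w \<noteq> 2")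
    case True
    then obtain w where "w \<in> S" "degree G w \<noteq> 2" using deg S(1) by auto
    then obtain C where C: "C \<in> components (suppressed G)"
      "2 * size (edges C) = sum (degree G) {v \<in> S. degree G v \<noteq> 2}"
      using suppressed_component[OF simple _ S(2)] S(1) V by metis
    have "sum (degree G) {v \<in> S. degree G v \<noteq> 2} = branch_weight d S"
      unfolding branch_weight_def using deg S(1) by (intro sum.cong) auto
    then have "real (branch_weight d S) = 2 * real (size (edges C))" using C(2) by simp
    moreover have "real (size (edges C)) < \<rho> * real (M_deg n d)" using small C(1) by force
    ultimately show ?thesis by simp
  next
    case False
    then have "{v \<in> S. d v \<noteq> 2} = {}" by blast
    then have "branch_weight d S = 0" unfolding branch_weight_def by (simp only: sum.empty)
    then show ?thesis using M \<rho> by simp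
  qed
qed

section \<open>Choice of the constants and conclusion\<close>

lemma dense_rate_small:
  fixes \<epsilon> :: real
  assumes "\<epsilon> > 0"
  obtains t :: nat where "(2 * real t + 1) / 4 ^ t \<le> \<epsilon>"
proof -
  obtain t where t: "2 / \<epsilon> < 2 ^ t" using real_arch_pow[of 2 "2 / \<epsilon>"] by auto
  \<comment> \<open>Hence the quotient is at most \<open>2 / 2 ^ t\<close>.\<close>
  have "2 * real t + 1 \<le> 2 * 2 ^ t"
  proof (induction t)
    case (Suc t)
    have "(1 :: real) \<le> 2 ^ t" by simp
    then have "2 * real t + 3 \<le> 4 * 2 ^ t" using Suc by linarith
    then show ?case by simp
  qed simp
  also have "\<dots> \<le> \<epsilon> * 2 ^ t * 2 ^ t"
    using t assms by (intro mult_right_mono) (auto simp: field_simps)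
  also have "\<dots> = \<epsilon> * 4 ^ t" by (simp add: power_mult_distrib[symmetric])
  finally have "(2 * real t + 1) / 4 ^ t \<le> \<epsilon>" by (simp add: field_simps)
  then show ?thesis by (rule that)
qed

theorem theorem4:
  fixes lam :: "nat \<Rightarrow> nat" and \<gamma> :: real
  assumes "filterlim lam at_top sequentially"
    and "\<gamma> > 0"
  shows "\<exists>\<rho>>0. \<forall>\<epsilon>>0. \<exists>N. \<forall>n\<ge>N. \<forall>d.
    degree_sequence n d \<and> feasible n d \<and> well_behaved lam n d \<longrightarrow>
    measure_pmf.prob (random_graph n d)
      {G. (\<exists>C \<in> components G. real (card (verts C)) \<ge> \<gamma> * real n) \<and>
          \<not> (\<exists>C \<in> components (suppressed G). real (size (edges C)) \<ge> \<rho> * real (M_deg n d))}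
      \<le> (\<epsilon>::real)"
proof -
  \<comment> \<open>Both cases use \<open>1 / 10\<close>; the sparse case also uses
    \<open>\<gamma> / 5000\<close>.\<close>
  define \<rho> where "\<rho> = min (1 / 10) (\<gamma> / 5000)"
  have \<rho>: "0 < \<rho>" "\<rho> \<le> 1 / 10" "\<rho> \<le> \<gamma> / 5000" using assms(2) by (auto simp: \<rho>_def)
  show ?thesis
  proof (intro exI[of _ \<rho>] conjI allI impI \<rho>(1))
    fix \<epsilon> :: real assume \<epsilon>: "\<epsilon> > 0"
    obtain t :: nat where t: "(2 * real t + 1) / 4 ^ t \<le> \<epsilon>" by (rule dense_rate_small[OF \<epsilon>])
    \<comment> \<open>The lower bound on the branch weight: 16 and the last summand are for the
      sparse case, where the probability is at most \<open>512 / (\<gamma>^2 * ?m)\<close>, and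
      \<open>441 * t^2\<close> is for the dense case.\<close>
    define L where "L = 16 + 441 * t\<^sup>2 + nat \<lceil>512 / (\<gamma>\<^sup>2 * \<epsilon>)\<rceil>"
    \<comment> \<open>This makes \<open>n\<close> positive, at least \<open>2 * t\<close> for the
      dense case, and at least \<open>16 / \<gamma>\<close> for the sparse case.\<close>
    define N' where "N' = 1 + 2 * t + nat \<lceil>16 / \<gamma>\<rceil>"
    have "eventually (\<lambda>n. L \<le> lam n) sequentially"
      using assms(1) by (simp add: filterlim_at_top)
    then obtain N where N: "\<And>n. n \<ge> N \<Longrightarrow> L \<le> lam n" by (auto simp: eventually_sequentially)
    show "\<exists>N. \<forall>n\<ge>N. \<forall>d. degree_sequence n d \<and> feasible n d \<and> well_behaved lam n d \<longrightarrow>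
      measure_pmf.prob (random_graph n d)
        {G. (\<exists>C \<in> components G. real (card (verts C)) \<ge> \<gamma> * real n) \<and>
          \<not> (\<exists>C \<in> components (suppressed G). real (size (edges C)) \<ge> \<rho> * real (M_deg n d))} \<le> \<epsilon>"
    proof (intro exI[of _ "max N N'"] allI impI)
      fix n d
      assume n: "max N N' \<le> n" and D: "degree_sequence n d \<and> feasible n d \<and> well_behaved lam n d"
      let ?V = "{1..n}" and ?R = "realizations {1..n} d" and ?m = "branch_weight d {1..n}"
      let ?B = "{G. (\<exists>C \<in> components G. real (card (verts C)) \<ge> \<gamma> * real n) \<and>
          \<not> (\<exists>C \<in> components (suppressed G). real (size (edges C)) \<ge> \<rho> * real (M_deg n d))}"
      let ?Bad = "{E \<in> ?R. no_heavy_component ?V d (\<gamma> * real n) (2 * \<rho> * real ?m) E}"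
      have m: "M_deg n d = ?m" by (simp add: M_deg_def branch_weight_def)
      have Lm: "L \<le> ?m" using D N[of n] n m by (auto simp: well_behaved_def)
      have nN: "N' \<le> n" using n by simp
      have ne: "graphs_with_degrees n d \<noteq> {}" using D by (simp add: feasible_def)
      have bij: "card (graphs_with_degrees n d) = card ?R"
        by (rule bij_betw_same_card[OF bij_betw_edge_sets])
      have R: "real (card ?R) > 0"
        using ne finite_graphs_with_degrees[of n d] unfolding bij[symmetric] of_nat_0_less_iff
        by (simp add: card_gt_0_iff)
      have "card (graphs_with_degrees n d \<inter> ?B) = card (edge_sets ` (graphs_with_degrees n d \<inter> ?B))"
        using bij_betw_imp_inj_on[OF bij_betw_edge_sets, of n d]
        by (intro card_image[symmetric]) (auto intro: inj_on_subset)
      also have "\<dots> \<le> card ?Bad"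
      proof (rule card_mono)
        show "finite ?Bad" by (simp add: finite_realizations)
        show "edge_sets ` (graphs_with_degrees n d \<inter> ?B) \<subseteq> ?Bad"
        proof
          fix E assume "E \<in> edge_sets ` (graphs_with_degrees n d \<inter> ?B)"
          then obtain G where G: "G \<in> graphs_with_degrees n d" "G \<in> ?B" "E = edge_sets G" by blast
          have "E \<in> ?R" using bij_betw_imp_surj_on[OF bij_betw_edge_sets] G(1,3) by blast
          moreover have "no_heavy_component ?V d (\<gamma> * real n) (2 * \<rho> * real (M_deg n d)) (edge_sets G)"
            using D G(2) Lm m by (intro bad_event_no_heavy_component[OF _ _ \<rho>(1) G(1)]) (auto simp: L_def)
          ultimately show "E \<in> ?Bad" using G(3) m by simp
        qed
      qed
      finally have le: "card (graphs_with_degrees n d \<inter> ?B) \<le> card ?Bad" .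
      have "real (card ?Bad) \<le> \<epsilon> * real (card ?R)"
      proof (cases "?m \<le> 200 * n")
        case True
        have "16 / \<gamma> \<le> real n" using nN unfolding N'_def by linarith
        then have "16 \<le> \<gamma> * real n" using assms(2) by (simp add: field_simps)
        then have "real (card ?Bad) * (\<gamma>\<^sup>2 * real ?m) \<le> 512 * real (card ?R)"
          using card_no_heavy_sparse[of ?V d \<gamma> \<rho>] D True assms(2) \<rho> Lm
          by (auto simp: degree_sequence_def L_def)
        moreover have "512 \<le> \<epsilon> * (\<gamma>\<^sup>2 * real ?m)"
        proof -
          have "512 / (\<gamma>\<^sup>2 * \<epsilon>) \<le> real ?m" using Lm unfolding L_def by linarith
          then show ?thesis using assms(2) \<epsilon> by (simp add: field_simps)
        qed
        then have "512 * real (card ?R) \<le> \<epsilon> * (\<gamma>\<^sup>2 * real ?m) * real (card ?R)"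
          by (intro mult_right_mono) auto
        ultimately have "real (card ?Bad) * (\<gamma>\<^sup>2 * real ?m) \<le> (\<epsilon> * real (card ?R)) * (\<gamma>\<^sup>2 * real ?m)"
          by (simp add: algebra_simps)
        moreover have "0 < \<gamma>\<^sup>2 * real ?m" using assms(2) Lm by (simp add: L_def)
        ultimately show ?thesis by (subst (asm) mult_le_cancel_right_pos)
      next
        case False
        have "real (card ?Bad) \<le> (2 * real t + 1) / 4 ^ t * real (card ?R)"
          using False Lm nN \<rho> by (intro card_no_heavy_dense) (auto simp: L_def N'_def)
        also have "\<dots> \<le> \<epsilon> * real (card ?R)" by (intro mult_right_mono t) simp
        finally show ?thesis .
      qed
      then have "real (card (graphs_with_degrees n d \<inter> ?B)) \<le> \<epsilon> * real (card ?R)" using le by linarith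
      then show "measure_pmf.prob (random_graph n d) ?B \<le> \<epsilon>"
        unfolding random_graph_def measure_pmf_of_set[OF ne finite_graphs_with_degrees] bij
        using R by (simp add: field_simps)
    qed
  qed
qed

end
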